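(* Let $\mathcal{M}_4$ be a closed, oriented combinatorial $4$-manifold equipped with a triangulation whose vertex set $\Lambda_0$ is finite and totally ordered, and let $(L\xrightarrow{\delta}H\xrightarrow{\partial}G,\rhd,\{\cdot,\cdot\}_{\mathrm p})$ be a $2$-crossed module of finite groups. Let $Z$ be the state sum defined in the context below. Then $Z$ is invariant under the Pachner moves $1\leftrightarrow5$, $2\leftrightarrow4$ and $3\leftrightarrow3$: if two such ordered triangulations of $\mathcal{M}_4$ are related by one of these moves, their state sums $Z$ coincide. Consequently $Z$ does not depend on the chosen triangulation and is a topological invariant of $\mathcal{M}_4$.
   Context: A 2-crossed module $(L\xrightarrow{\delta}H\xrightarrow{\partial}G,\rhd,\{\cdot,\cdot\}_{\mathrm p})$ consists of groups $G,H,L$, homomorphisms $\delta:L\to H$, $\partial:H\to G$ with $\partial\delta$ trivial, a left action $\rhd$ of $G$ on $G$ (by conjugation, $g_1\rhd g_2=g_1g_2g_1^{-1}$), on $H$ and on $L$ by automorphisms, such that $\partial$ and $\delta$ are $G$-equivariant ($g\rhd\partial(h)=\partial(g\rhd h)$, $g\rhd\delta(l)=\delta(g\rhd l)$), and a map $\{\cdot,\cdot\}_{\mathrm p}:H\times H\to L$ (Peiffer lifting) that is $G$-equivariant ($g\rhd\{h_1,h_2\}_{\mathrm p}=\{g\rhd h_1,g\rhd h_2\}_{\mathrm p}$) and satisfies, for all $h,h_1,h_2,h_3\in H$, $l,l_1,l_2\in L$: (1) $\delta(\{h_1,h_2\}_{\mathrm p})=\langle h_1,h_2\rangle_{\mathrm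 p}$, where $\langle h_1,h_2\rangle_{\mathrm p}=h_1h_2h_1^{-1}\,\partial(h_1)\rhd h_2^{-1}$ is the Peiffer commutator; (2) $l_1l_2l_1^{-1}l_2^{-1}=\{\delta(l_1),\delta(l_2)\}_{\mathrm p}$; (3) $\{h_1h_2,h_3\}_{\mathrm p}=\{h_1,h_2h_3h_2^{-1}\}_{\mathrm p}\;\partial(h_1)\rhd\{h_2,h_3\}_{\mathrm p}$; (4) $\{h_1,h_2h_3\}_{\mathrm p}=\{h_1,h_2\}_{\mathrm p}\{h_1,h_3\}_{\mathrm p}\{\langle h_1,h_3\rangle_{\mathrm p}^{-1},\partial(h_1)\rhd h_2\}_{\mathrm p}$; (5) $\{\delta(l),h\}_{\mathrm p}\{h,\delta(l)\}_{\mathrm p}=l\,(\partial(h)\rhd l^{-1})$. The action $\rhd'$ of $H$ on $L$ is defined by $h\rhd' l=l\,\{\delta(l)^{-1},h\}_{\mathrm p}$. For a finite group $K$, $\int_K dk\,f(k)=\frac1{|K|}\sum_{k\in K}f(k)$, and $\delta_K(k)=|K|$ if $k$ is the identity $e$ and $\delta_K(k)=0$ otherwise. $\Lambda_k$ denotes the set of $k$-simplices of the triangulation; each $k$-simplex is written $(i_0\dots i_k)$ with vertices $i_0<\dots<i_k$. Edges $(jk)$ carry $g_{jk}\in G$, triangles $(jk\ell)$ carry $h_{jk\ell}\in H$, tetrahedra $(jk\ell m)$ carry $l_{jk\ell m}\in L$. The state sum is $$Z=|G|^{-|\Lambda_0|+|\Lambda_1|-|\Lambda_2|}\,|H|^{|\Lambda_0|-|\Lambda_1|+|\Lambda_2|-|\Lambda_3|}\,|L|^{-|\Lambda_0|+|\Lambda_1|-|\Lambda_2|+|\Lambda_3|-|\Lambda_4|}\Big(\prod_{(jk)\in\Lambda_1}\int_G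 dg_{jk}\Big)\Big(\prod_{(jk\ell)\in\Lambda_2}\int_H dh_{jk\ell}\Big)\Big(\prod_{(jk\ell m)\in\Lambda_3}\int_L dl_{jk\ell m}\Big)$$ $$\times\prod_{(jk\ell)\in\Lambda_2}\delta_G\big(\partial(h_{jk\ell})g_{k\ell}g_{jk}g_{j\ell}^{-1}\big)\prod_{(jk\ell m)\in\Lambda_3}\delta_H\big(\delta(l_{jk\ell m})h_{j\ell m}(g_{\ell m}\rhd h_{jk\ell})h_{k\ell m}^{-1}h_{jkm}^{-1}\big)$$ $$\times\prod_{(jk\ell mn)\in\Lambda_4}\delta_L\Big(l_{j\ell mn}^{-1}\;\big(h_{j\ell n}\rhd'\{h_{\ell mn},(g_{mn}g_{\ell m})\rhd h_{jk\ell}\}_{\mathrm p}\big)\;l_{jk\ell n}^{-1}\;(h_{jkn}\rhd' l_{k\ell mn})\;l_{jkmn}\;\big(h_{jmn}\rhd'(g_{mn}\rhd l_{jk\ell m})\big)\Big).$$ The Pachner moves in dimension 4 replace $k$ 4-simplices glued along a common boundary portion by the complementary $6-k$ 4-simplices of the boundary of a 5-simplex ($k=1,\dots,5$), i.e. the moves $1\leftrightarrow5$, $2\leftrightarrow4$, $3\leftrightarrow3$; any two triangulations of the same PL 4-manifold are related by a finite sequence of them. *)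

theory Defs
  imports Complex_Main "HOL-Algebra.Group"
begin

definition peiffer_comm ::
  "('h, 'a) monoid_scheme \<Rightarrow> ('g \<Rightarrow> 'h \<Rightarrow> 'h) \<Rightarrow> ('h \<Rightarrow> 'g) \<Rightarrow> 'h \<Rightarrow> 'h \<Rightarrow> 'h" where
  "peiffer_comm H aH bd h1 h2 =
     h1 \<otimes>\<^bsub>H\<^esub> h2 \<otimes>\<^bsub>H\<^esub> inv\<^bsub>H\<^esub> h1 \<otimes>\<^bsub>H\<^esub> aH (bd h1) (inv\<^bsub>H\<^esub> h2)"

definition action_by_automorphisms ::
  "('g, 'a) monoid_scheme \<Rightarrow> ('x, 'b) monoid_scheme \<Rightarrow> ('g \<Rightarrow> 'x \<Rightarrow> 'x) \<Rightarrow> bool" where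
  "action_by_automorphisms G X act \<longleftrightarrow>
     (\<forall>g\<in>carrier G. \<forall>x\<in>carrier X. act g x \<in> carrier X) \<and>
     (\<forall>x\<in>carrier X. act \<one>\<^bsub>G\<^esub> x = x) \<and>
     (\<forall>g1\<in>carrier G. \<forall>g2\<in>carrier G. \<forall>x\<in>carrier X.
        act (g1 \<otimes>\<^bsub>G\<^esub> g2) x = act g1 (act g2 x)) \<and>
     (\<forall>g\<in>carrier G. act g \<in> hom X X)"

definition two_crossed_module ::
  "('g, 'a) monoid_scheme \<Rightarrow> ('h, 'b) monoid_scheme \<Rightarrow> ('l, 'c) monoid_scheme \<Rightarrow>
   ('h \<Rightarrow> 'g) \<Rightarrow> ('l \<Rightarrow> 'h) \<Rightarrow> ('g \<Rightarrow> 'h \<Rightarrow> 'h) \<Rightarrow> ('g \<Rightarrow> 'l \<Rightarrow> 'l) \<Rightarrow>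
   ('h \<Rightarrow> 'h \<Rightarrow> 'l) \<Rightarrow> bool" where
  "two_crossed_module G H L bd dl aH aL pl \<longleftrightarrow>
     group G \<and> group H \<and> group L \<and>
     bd \<in> hom H G \<and> dl \<in> hom L H \<and>
     (\<forall>l\<in>carrier L. bd (dl l) = \<one>\<^bsub>G\<^esub>) \<and>
     action_by_automorphisms G H aH \<and> action_by_automorphisms G L aL \<and>
     (\<forall>g\<in>carrier G. \<forall>h\<in>carrier H.
        bd (aH g h) = g \<otimes>\<^bsub>G\<^esub> bd h \<otimes>\<^bsub>G\<^esub> inv\<^bsub>G\<^esub> g) \<and>
     (\<forall>g\<in>carrier G. \<forall>l\<in>carrier L. dl (aL g l) = aH g (dl l)) \<and>
     (\<forall>h1\<in>carrier H. \<forall>h2\<in>carrier H. pl h1 h2 \<in> carrier L) \<and>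
     (\<forall>g\<in>carrier G. \<forall>h1\<in>carrier H. \<forall>h2\<in>carrier H.
        aL g (pl h1 h2) = pl (aH g h1) (aH g h2)) \<and>
     \<comment> \<open>(1)\<close>
     (\<forall>h1\<in>carrier H. \<forall>h2\<in>carrier H. dl (pl h1 h2) = peiffer_comm H aH bd h1 h2) \<and>
     \<comment> \<open>(2)\<close>
     (\<forall>l1\<in>carrier L. \<forall>l2\<in>carrier L.
        l1 \<otimes>\<^bsub>L\<^esub> l2 \<otimes>\<^bsub>L\<^esub> inv\<^bsub>L\<^esub> l1 \<otimes>\<^bsub>L\<^esub> inv\<^bsub>L\<^esub> l2 = pl (dl l1) (dl l2)) \<and>
     \<comment> \<open>(3)\<close>
     (\<forall>h1\<in>carrier H. \<forall>h2\<in>carrier H. \<forall>h3\<in>carrier H.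
        pl (h1 \<otimes>\<^bsub>H\<^esub> h2) h3 =
          pl h1 (h2 \<otimes>\<^bsub>H\<^esub> h3 \<otimes>\<^bsub>H\<^esub> inv\<^bsub>H\<^esub> h2) \<otimes>\<^bsub>L\<^esub> aL (bd h1) (pl h2 h3)) \<and>
     \<comment> \<open>(4)\<close>
     (\<forall>h1\<in>carrier H. \<forall>h2\<in>carrier H. \<forall>h3\<in>carrier H.
        pl h1 (h2 \<otimes>\<^bsub>H\<^esub> h3) =
          pl h1 h2 \<otimes>\<^bsub>L\<^esub> pl h1 h3 \<otimes>\<^bsub>L\<^esub>
          pl (inv\<^bsub>H\<^esub> (peiffer_comm H aH bd h1 h3)) (aH (bd h1) h2)) \<and>
     \<comment> \<open>(5)\<close>
     (\<forall>l\<in>carrier L. \<forall>h\<in>carrier H.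
        pl (dl l) h \<otimes>\<^bsub>L\<^esub> pl h (dl l) = l \<otimes>\<^bsub>L\<^esub> aL (bd h) (inv\<^bsub>L\<^esub> l))"

definition actH ::
  "('h, 'b) monoid_scheme \<Rightarrow> ('l, 'c) monoid_scheme \<Rightarrow> ('l \<Rightarrow> 'h) \<Rightarrow> ('h \<Rightarrow> 'h \<Rightarrow> 'l) \<Rightarrow>
   'h \<Rightarrow> 'l \<Rightarrow> 'l" where
  "actH H L dl pl h l = l \<otimes>\<^bsub>L\<^esub> pl (inv\<^bsub>H\<^esub> (dl l)) h"

definition grp_delta :: "('g, 'a) monoid_scheme \<Rightarrow> 'g \<Rightarrow> real" where
  "grp_delta K k = (if k = \<one>\<^bsub>K\<^esub> then real (card (carrier K)) else 0)"

text \<open>Product over a finite set S of simplices of normalised Haar integrals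
  over K:  (prod_{s in S} int_K dk_s) F  =  |K|^(-|S|) * sum over all colourings.\<close>
definition grp_multi_int ::
  "('g, 'a) monoid_scheme \<Rightarrow> 'x set \<Rightarrow> (('x \<Rightarrow> 'g) \<Rightarrow> real) \<Rightarrow> real" where
  "grp_multi_int K S F =
     (\<Sum>c \<in> S \<rightarrow>\<^sub>E carrier K. F c) / real (card (carrier K)) ^ card S"

text \<open>A (pure) triangulation is given by its set of top simplices (facets); vertices
  are natural numbers, ordered by the order of nat.\<close>
type_synonym complex = "nat set set"

definition faces :: "complex \<Rightarrow> nat \<Rightarrow> nat set set" where
  "faces K k = {s. (\<exists>F\<in>K. s \<subseteq> F) \<and> card s = Suc k}"

definition vx :: "nat set \<Rightarrow> nat \<Rightarrow> nat" where
  "vx s i = sorted_list_of_set s ! i"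

definition bistellar_move :: "nat \<Rightarrow> complex \<Rightarrow> complex \<Rightarrow> bool" where
  "bistellar_move d K K' \<longleftrightarrow>
     (\<exists>S A. card S = d + 2 \<and> A \<subseteq> S \<and> A \<noteq> {} \<and> A \<noteq> S \<and>
        (\<forall>v\<in>A. S - {v} \<in> K) \<and>
        (\<forall>F\<in>K. S - A \<subseteq> F \<longrightarrow> (\<exists>v\<in>A. F = S - {v})) \<and>
        (\<forall>F\<in>K. \<not> A \<subseteq> F) \<and>
        K' = (K - (\<lambda>v. S - {v}) ` A) \<union> (\<lambda>v. S - {v}) ` (S - A))"

definition pl_sphere :: "nat \<Rightarrow> complex \<Rightarrow> bool" where
  "pl_sphere d K \<longleftrightarrow>
     (\<exists>S. card S = d + 2 \<and> (bistellar_move d)\<^sup>*\<^sup>* ((\<lambda>v. S - {v}) ` S) K)"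

definition vlink :: "complex \<Rightarrow> nat \<Rightarrow> complex" where
  "vlink K v = (\<lambda>F. F - {v}) ` {F \<in> K. v \<in> F}"

definition closed_comb_manifold :: "nat \<Rightarrow> complex \<Rightarrow> bool" where
  "closed_comb_manifold d K \<longleftrightarrow>
     finite K \<and> (\<forall>F\<in>K. card F = d + 1) \<and>
     (\<forall>v\<in>\<Union>K. pl_sphere (d - 1) (vlink K v))"

text \<open>Orientability: facets carry signs such that adjacent facets induce opposite
  orientations on their common codimension-1 face.\<close>
definition vpos :: "nat set \<Rightarrow> nat \<Rightarrow> nat" where
  "vpos F v = card {w \<in> F. w < v}"

definition orientable :: "complex \<Rightarrow> bool" where
  "orientable K \<longleftrightarrow>
     (\<exists>\<epsilon> :: nat set \<Rightarrow> int. (\<forall>F\<in>K. \<epsilon> F = 1 \<or> \<epsilon> F = -1) \<and>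
        (\<forall>F1\<in>K. \<forall>F2\<in>K. \<forall>v1\<in>F1. \<forall>v2\<in>F2.
           F1 \<noteq> F2 \<and> F1 - {v1} = F2 - {v2} \<longrightarrow>
           \<epsilon> F1 * (-1) ^ vpos F1 v1 = - (\<epsilon> F2 * (-1) ^ vpos F2 v2)))"

definition closed_oriented_triangulated_4manifold :: "complex \<Rightarrow> bool" where
  "closed_oriented_triangulated_4manifold K \<longleftrightarrow>
     closed_comb_manifold 4 K \<and> orientable K"

definition pachner_move :: "complex \<Rightarrow> complex \<Rightarrow> bool" where
  "pachner_move K K' \<longleftrightarrow>
     closed_oriented_triangulated_4manifold K \<and>
     closed_oriented_triangulated_4manifold K' \<and> bistellar_move 4 K K'"

definition state_sum ::
  "('g, 'a) monoid_scheme \<Rightarrow> ('h, 'b) monoid_scheme \<Rightarrow> ('l, 'c) monoid_scheme \<Rightarrow>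
   ('h \<Rightarrow> 'g) \<Rightarrow> ('l \<Rightarrow> 'h) \<Rightarrow> ('g \<Rightarrow> 'h \<Rightarrow> 'h) \<Rightarrow> ('g \<Rightarrow> 'l \<Rightarrow> 'l) \<Rightarrow>
   ('h \<Rightarrow> 'h \<Rightarrow> 'l) \<Rightarrow> complex \<Rightarrow> real" where
  "state_sum G H L bd dl aH aL pl K =
    (let n = (\<lambda>k. int (card (faces K k)));
         nG = real (card (carrier G)); nH = real (card (carrier H));
         nL = real (card (carrier L));
         act' = actH H L dl pl
     in nG powi (- n 0 + n 1 - n 2) *
        nH powi (n 0 - n 1 + n 2 - n 3) *
        nL powi (- n 0 + n 1 - n 2 + n 3 - n 4) *
        grp_multi_int G (faces K 1) (\<lambda>g.
        grp_multi_int H (faces K 2) (\<lambda>h.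
        grp_multi_int L (faces K 3) (\<lambda>l.
          (\<Prod>t\<in>faces K 2.
             let a = vx t 0; b = vx t 1; c = vx t 2 in
             grp_delta G (bd (h t) \<otimes>\<^bsub>G\<^esub> g {b,c} \<otimes>\<^bsub>G\<^esub> g {a,b}
                           \<otimes>\<^bsub>G\<^esub> inv\<^bsub>G\<^esub> (g {a,c}))) *
          (\<Prod>s\<in>faces K 3.
             let a = vx s 0; b = vx s 1; c = vx s 2; d = vx s 3 in
             grp_delta H (dl (l s) \<otimes>\<^bsub>H\<^esub> h {a,c,d} \<otimes>\<^bsub>H\<^esub> aH (g {c,d}) (h {a,b,c})
                           \<otimes>\<^bsub>H\<^esub> inv\<^bsub>H\<^esub> (h {b,c,d}) \<otimes>\<^bsub>H\<^esub> inv\<^bsub>H\<^esub> (h {a,b,d}))) *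
          (\<Prod>p\<in>faces K 4.
             let a = vx p 0; b = vx p 1; c = vx p 2; d = vx p 3; e = vx p 4 in
             grp_delta L (inv\<^bsub>L\<^esub> (l {a,c,d,e})
               \<otimes>\<^bsub>L\<^esub> act' (h {a,c,e}) (pl (h {c,d,e}) (aH (g {d,e} \<otimes>\<^bsub>G\<^esub> g {c,d}) (h {a,b,c})))
               \<otimes>\<^bsub>L\<^esub> inv\<^bsub>L\<^esub> (l {a,b,c,e})
               \<otimes>\<^bsub>L\<^esub> act' (h {a,b,e}) (l {b,c,d,e})
               \<otimes>\<^bsub>L\<^esub> l {a,b,d,e}
               \<otimes>\<^bsub>L\<^esub> act' (h {a,d,e}) (aL (g {d,e}) (l {a,b,c,d}))))))))"

end

(*
  Evaluating the delta functions turns Z into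
    |G|^(-n0) |H|^(n0-n1) |L|^(-n0+n1-n2) * #(flat colourings)   (n_k the number of k-simplices),
  which makes sense for every finite simplicial complex X. Flat colourings behave like simplicial
  maps into a Kan complex: if all facets of a simplex T but T - {u} are flatly coloured, then every
  colour of T determines a unique flat colour of T - {u}. Hence the normalised count does not change
  under an elementary expansion, which adds T together with its free face T - {u}. A bistellar move
  exchanges two balls in the boundary of a simplex S, and filling in all of S is a composite of
  elementary expansions on either side.

  Unique filling is a solvable equation in G, H or L up to dimension 4. In dimension 5 it says that
  flatness of five facets forces flatness of the sixth. This is the cocycle identity for the
  curvatures of the six facets; these lie in ker dl, which is central in L.
*)
theory Submission
  imports Defs
begin

section \<open>Identities in a 2-crossed module\<close>

text \<open>Filling a horn involves two separate facts. The equation of T determines the colour of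
  the missing face because each face occurs in it exactly once, up to an invertible action. That the
  face so found is itself flat is a "boundary of a boundary" identity: here the triviality of
  \<open>bd\<close> after \<open>dl\<close>, equivariance and the Peiffer commutator formula enter.

  Fillers are needed for every vertex u of T, as the vertex left out during a move can stand
  anywhere in the vertex order. In return, all three kinds of moves and all orderings are treated at
  once.

  The obstacle is the cocycle identity, a relation between long words in a nonabelian group with two
  actions. It becomes manageable once the Peiffer lifting is seen as the interchanger of a Gray
  category whose cells of dimension 1, 2, 3 are coloured by G, H, L. The axioms are therefore recast
  as laws for products in either argument (\<open>pl_mult_left'\<close>,
  \<open>pl_mult_right'\<close>) and as naturality of the lifting along \<open>dl\<close>
  (\<open>pl_natural_left\<close>, \<open>pl_natural_right\<close>).\<close>

locale two_crossed_module_loc =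
  fixes G :: "('g, 'a) monoid_scheme" and H :: "('h, 'b) monoid_scheme"
    and L :: "('l, 'c) monoid_scheme" (structure)
    and bd :: "'h \<Rightarrow> 'g" and dl :: "'l \<Rightarrow> 'h"
    and aH :: "'g \<Rightarrow> 'h \<Rightarrow> 'h" and aL :: "'g \<Rightarrow> 'l \<Rightarrow> 'l"
    and pl :: "'h \<Rightarrow> 'h \<Rightarrow> 'l"
  assumes tcm: "two_crossed_module G H L bd dl aH aL pl"
begin

sublocale G: group G using tcm by (simp add: two_crossed_module_def)
sublocale H: group H using tcm by (simp add: two_crossed_module_def)
sublocale L: group L using tcm by (simp add: two_crossed_module_def)

sublocale bd: group_hom H G bd
  using tcm by unfold_locales (simp add: two_crossed_module_def)
sublocale dl: group_hom L H dl
  using tcm by unfold_locales (simp add: two_crossed_module_def)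

abbreviation mulG (infixl "\<cdot>" 78) where "x \<cdot> y \<equiv> x \<otimes>\<^bsub>G\<^esub> y"
abbreviation mulH (infixl "\<odot>" 78) where "x \<odot> y \<equiv> x \<otimes>\<^bsub>H\<^esub> y"
abbreviation act (infixr "\<rhd>" 75) where "h \<rhd> l \<equiv> actH H L dl pl h l"

lemma aH_hom: "g \<in> carrier G \<Longrightarrow> group_hom H H (aH g)"
  and aL_hom: "g \<in> carrier G \<Longrightarrow> group_hom L L (aL g)"
  using tcm
  by (auto simp: two_crossed_module_def action_by_automorphisms_def group_hom_def group_hom_axioms_def)

lemma aH_closed [simp]: "g \<in> carrier G \<Longrightarrow> x \<in> carrier H \<Longrightarrow> aH g x \<in> carrier H"
  and aL_closed [simp]: "g \<in> carrier G \<Longrightarrow> y \<in> carrier L \<Longrightarrow> aL g y \<in> carrier L"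
  and pl_closed [simp]: "x \<in> carrier H \<Longrightarrow> x' \<in> carrier H \<Longrightarrow> pl x x' \<in> carrier L"
  and aH_one_act [simp]: "x \<in> carrier H \<Longrightarrow> aH \<one>\<^bsub>G\<^esub> x = x"
  and aL_one_act [simp]: "y \<in> carrier L \<Longrightarrow> aL \<one>\<^bsub>G\<^esub> y = y"
  and bd_dl [simp]: "y \<in> carrier L \<Longrightarrow> bd (dl y) = \<one>\<^bsub>G\<^esub>"
  using tcm by (auto simp: two_crossed_module_def action_by_automorphisms_def)

lemma aH_act: "g \<in> carrier G \<Longrightarrow> g' \<in> carrier G \<Longrightarrow> x \<in> carrier H \<Longrightarrow> aH (g \<cdot> g') x = aH g (aH g' x)"
  and aL_act: "g \<in> carrier G \<Longrightarrow> g' \<in> carrier G \<Longrightarrow> y \<in> carrier L \<Longrightarrow> aL (g \<cdot> g') y = aL g (aL g' y)"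
  and bd_aH: "g \<in> carrier G \<Longrightarrow> x \<in> carrier H \<Longrightarrow> bd (aH g x) = g \<cdot> bd x \<cdot> inv\<^bsub>G\<^esub> g"
  and dl_aL [simp]: "g \<in> carrier G \<Longrightarrow> y \<in> carrier L \<Longrightarrow> dl (aL g y) = aH g (dl y)"
  and aL_pl: "g \<in> carrier G \<Longrightarrow> x \<in> carrier H \<Longrightarrow> x' \<in> carrier H \<Longrightarrow>
    aL g (pl x x') = pl (aH g x) (aH g x')"
  and dl_pl_comm: "x \<in> carrier H \<Longrightarrow> x' \<in> carrier H \<Longrightarrow> dl (pl x x') = peiffer_comm H aH bd x x'"
  and pl_dl_dl: "y \<in> carrier L \<Longrightarrow> y' \<in> carrier L \<Longrightarrow> pl (dl y) (dl y') = y \<otimes> y' \<otimes> inv y \<otimes> inv y'"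
  and pl_mult_left: "x \<in> carrier H \<Longrightarrow> x' \<in> carrier H \<Longrightarrow> z \<in> carrier H \<Longrightarrow>
    pl (x \<odot> x') z = pl x (x' \<odot> z \<odot> inv\<^bsub>H\<^esub> x') \<otimes> aL (bd x) (pl x' z)"
  and pl_mult_right: "z \<in> carrier H \<Longrightarrow> x \<in> carrier H \<Longrightarrow> x' \<in> carrier H \<Longrightarrow>
    pl z (x \<odot> x') = pl z x \<otimes> pl z x' \<otimes> pl (inv\<^bsub>H\<^esub> (peiffer_comm H aH bd z x')) (aH (bd z) x)"
  and pl_dl_swap: "y \<in> carrier L \<Longrightarrow> x \<in> carrier H \<Longrightarrow>
    pl (dl y) x \<otimes> pl x (dl y) = y \<otimes> aL (bd x) (inv y)"
  using tcm unfolding two_crossed_module_def action_by_automorphisms_def by (simp_all only:)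

lemmas aH_mult = group_hom.hom_mult[OF aH_hom] and aL_mult = group_hom.hom_mult[OF aL_hom]
  and aH_one [simp] = group_hom.hom_one[OF aH_hom] and aL_one [simp] = group_hom.hom_one[OF aL_hom]
  and aH_inv = group_hom.hom_inv[OF aH_hom] and aL_inv = group_hom.hom_inv[OF aL_hom]

lemma act_closed [simp]: "x \<in> carrier H \<Longrightarrow> y \<in> carrier L \<Longrightarrow> x \<rhd> y \<in> carrier L"
  by (simp add: actH_def)

lemma peiffer_comm_closed [simp]:
  "x \<in> carrier H \<Longrightarrow> x' \<in> carrier H \<Longrightarrow> peiffer_comm H aH bd x x' \<in> carrier H"
  by (simp add: peiffer_comm_def)

text \<open>With associativity and the inverse of a product, these rules bring a word to its
  reduced, right-nested form, so the simplifier decides identities of free groups.\<close>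

lemma L_cancel: "x \<in> carrier L \<Longrightarrow> y \<in> carrier L \<Longrightarrow> x \<otimes> (inv x \<otimes> y) = y"
  "x \<in> carrier L \<Longrightarrow> y \<in> carrier L \<Longrightarrow> inv x \<otimes> (x \<otimes> y) = y"
  by (simp_all flip: L.m_assoc)
lemma H_cancel: "x \<in> carrier H \<Longrightarrow> y \<in> carrier H \<Longrightarrow> x \<odot> (inv\<^bsub>H\<^esub> x \<odot> y) = y"
  "x \<in> carrier H \<Longrightarrow> y \<in> carrier H \<Longrightarrow> inv\<^bsub>H\<^esub> x \<odot> (x \<odot> y) = y"
  by (simp_all flip: H.m_assoc)
lemmas L_group = L.m_assoc L_cancel L.inv_mult_group
lemmas H_group = H.m_assoc H_cancel H.inv_mult_group

lemma pl_one_left [simp]: assumes "x \<in> carrier H" shows "pl \<one>\<^bsub>H\<^esub> x = \<one>"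
  using pl_mult_left[of "\<one>\<^bsub>H\<^esub>" "\<one>\<^bsub>H\<^esub>" x] assms by simp

lemma pl_one_right [simp]: assumes "x \<in> carrier H" shows "pl x \<one>\<^bsub>H\<^esub> = \<one>"
  using pl_mult_right[of x "\<one>\<^bsub>H\<^esub>" "\<one>\<^bsub>H\<^esub>"] assms by (simp add: peiffer_comm_def)

text \<open>Axiom (4) expands the lifting in the definition of the action. Since \<open>bd\<close>
  kills \<open>dl y\<close>, the two extra factors have both arguments in the image of
  \<open>dl\<close>, where axiom (2) makes them commutators. This precedes the action laws because
  it is what proves them.\<close>

lemma act_dl_mult:
  assumes "m \<in> carrier L" "x \<in> carrier H" "y \<in> carrier L"
  shows "dl m \<odot> x \<rhd> y = m \<otimes> (x \<rhd> y) \<otimes> inv m"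
proof -
  let ?z = "pl (inv\<^bsub>H\<^esub> (dl y)) x"
  have a: "pl (inv\<^bsub>H\<^esub> (dl y)) (dl m) = inv y \<otimes> m \<otimes> y \<otimes> inv m"
    using pl_dl_dl[of "inv y" m] assms by simp
  have b: "pl (inv\<^bsub>H\<^esub> (peiffer_comm H aH bd (inv\<^bsub>H\<^esub> (dl y)) x)) (dl m) = inv ?z \<otimes> m \<otimes> ?z \<otimes> inv m"
    using pl_dl_dl[of "inv ?z" m] assms by (simp add: dl_pl_comm)
  show ?thesis
    unfolding actH_def using assms by (simp add: pl_mult_right a b L_group)
qed

lemma act_dl: "m \<in> carrier L \<Longrightarrow> y \<in> carrier L \<Longrightarrow> dl m \<rhd> y = m \<otimes> y \<otimes> inv m"
  using act_dl_mult[of m "\<one>\<^bsub>H\<^esub>" y] by (simp add: actH_def)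

lemma act_one_act [simp]: "y \<in> carrier L \<Longrightarrow> \<one>\<^bsub>H\<^esub> \<rhd> y = y"
  by (simp add: actH_def)

text \<open>Axiom (3) conjugates \<open>x\<close> by \<open>?a\<close>. As \<open>bd ?a\<close> is
  trivial, the conjugate equals \<open>dl (pl ?a x) \<odot> x\<close>, so \<open>act_dl_mult\<close>
  replaces it by a conjugation in L, which cancels against the neighbouring
  \<open>pl ?a x\<close>.\<close>

lemma act_act:
  assumes "x \<in> carrier H" "x' \<in> carrier H" "y \<in> carrier L"
  shows "x \<odot> x' \<rhd> y = x \<rhd> x' \<rhd> y"
proof -
  let ?a = "inv\<^bsub>H\<^esub> (dl y)" and ?z = "pl (inv\<^bsub>H\<^esub> (dl y)) x'"
  have z: "dl ?z = ?a \<odot> x' \<odot> inv\<^bsub>H\<^esub> ?a \<odot> inv\<^bsub>H\<^esub> x'"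
    using assms by (simp add: dl_pl_comm peiffer_comm_def)
  have w: "dl (pl ?a x) \<odot> x = ?a \<odot> x \<odot> inv\<^bsub>H\<^esub> ?a"
    using assms by (simp add: dl_pl_comm peiffer_comm_def H_group)
  have "x \<rhd> x' \<rhd> y = y \<otimes> ?z \<otimes> pl (inv\<^bsub>H\<^esub> (dl ?z) \<odot> ?a) x"
    using assms by (simp add: actH_def[of _ _ _ _ x'] actH_def[of _ _ _ _ x] H.inv_mult_group)
  also have "\<dots> = y \<otimes> ?z \<otimes> (pl (inv\<^bsub>H\<^esub> (dl ?z)) (?a \<odot> x \<odot> inv\<^bsub>H\<^esub> ?a) \<otimes> pl ?a x)"
    using assms by (subst pl_mult_left) simp_all
  also have "\<dots> = y \<otimes> (dl (pl ?a x) \<odot> x \<rhd> ?z) \<otimes> pl ?a x"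
    using assms by (simp add: w actH_def L_group)
  also have "\<dots> = y \<otimes> pl ?a x \<otimes> (x \<rhd> ?z)"
    using assms by (subst act_dl_mult) (simp_all add: L_group)
  also have "\<dots> = x \<odot> x' \<rhd> y"
    using assms by (simp add: actH_def pl_mult_right dl_pl_comm L_group)
  finally show ?thesis by simp
qed

lemma dl_pl: "x \<in> carrier H \<Longrightarrow> x' \<in> carrier H \<Longrightarrow>
    dl (pl x x') = x \<odot> x' \<odot> inv\<^bsub>H\<^esub> x \<odot> aH (bd x) (inv\<^bsub>H\<^esub> x')"
  by (simp add: dl_pl_comm peiffer_comm_def)

lemma dl_act: "x \<in> carrier H \<Longrightarrow> y \<in> carrier L \<Longrightarrow> dl (x \<rhd> y) = x \<odot> dl y \<odot> inv\<^bsub>H\<^esub> x"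
  by (simp add: actH_def dl_pl H_group)

text \<open>The same mechanism as in \<open>act_act\<close>: axiom (3) produces a conjugate of
  \<open>x\<close>, which \<open>act_dl_mult\<close> absorbs.\<close>

lemma act_mult:
  assumes "x \<in> carrier H" "y \<in> carrier L" "y' \<in> carrier L"
  shows "x \<rhd> (y \<otimes> y') = (x \<rhd> y) \<otimes> (x \<rhd> y')"
proof -
  let ?a = "inv\<^bsub>H\<^esub> (dl y)" and ?a' = "inv\<^bsub>H\<^esub> (dl y')"
  have w: "dl (pl ?a x) \<odot> x = ?a \<odot> x \<odot> inv\<^bsub>H\<^esub> ?a"
    using assms by (simp add: dl_pl H_group)
  have "x \<rhd> (y \<otimes> y') = y \<otimes> y' \<otimes> pl (?a' \<odot> ?a) x"
    using assms by (simp add: actH_def H.inv_mult_group)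
  also have "\<dots> = y \<otimes> (dl (pl ?a x) \<odot> x \<rhd> y') \<otimes> pl ?a x"
    using assms by (subst pl_mult_left) (simp_all add: w actH_def L_group)
  also have "\<dots> = y \<otimes> pl ?a x \<otimes> (x \<rhd> y')"
    using assms by (subst act_dl_mult) (simp_all add: L_group)
  finally show ?thesis using assms by (simp add: actH_def)
qed

lemma act_hom: "x \<in> carrier H \<Longrightarrow> group_hom L L (\<lambda>y. x \<rhd> y)"
  by unfold_locales (auto simp: hom_def act_mult)
lemmas act_one [simp] = group_hom.hom_one[OF act_hom] and act_inv = group_hom.hom_inv[OF act_hom]

lemma aL_actH:
  assumes "g \<in> carrier G" "x \<in> carrier H" "y \<in> carrier L"
  shows "aL g (x \<rhd> y) = aH g x \<rhd> aL g y"
  using assms by (simp add: actH_def aL_mult aL_pl aH_inv)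

lemma dl_ker_act: "y \<in> carrier L \<Longrightarrow> dl y = \<one>\<^bsub>H\<^esub> \<Longrightarrow> x \<in> carrier H \<Longrightarrow> x \<rhd> y = y"
  by (simp add: actH_def)

lemma dl_ker_central:
  assumes "y \<in> carrier L" "dl y = \<one>\<^bsub>H\<^esub>" "z \<in> carrier L" shows "y \<otimes> z = z \<otimes> y"
proof -
  have "y \<otimes> z \<otimes> inv y \<otimes> inv z = \<one>" using pl_dl_dl[of y z] assms by simp
  then have "y \<otimes> z = inv (inv y \<otimes> inv z)"
    using assms by (intro L.inv_equality[symmetric]) (simp_all add: L_group)
  then show ?thesis using assms by (simp add: L_group)
qed

lemma pl_dl_left:
  assumes "y \<in> carrier L" "x \<in> carrier H" shows "pl (dl y) x = y \<otimes> inv (x \<rhd> y)"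
proof -
  have "x \<rhd> inv y = inv y \<otimes> pl (dl y) x" using assms by (simp add: actH_def)
  then show ?thesis using assms by (simp add: act_inv L_cancel)
qed

text \<open>Axiom (5) gives the product of the liftings in both orders; \<open>pl_dl_left\<close>
  removes the other one.\<close>

lemma pl_dl_right:
  assumes "y \<in> carrier L" "x \<in> carrier H" shows "pl x (dl y) = (x \<rhd> y) \<otimes> inv (aL (bd x) y)"
proof -
  have "pl x (dl y) = inv (pl (dl y) x) \<otimes> (y \<otimes> aL (bd x) (inv y))"
    using pl_dl_swap[of y x] assms by (metis L_cancel(2) bd.hom_closed dl.hom_closed pl_closed)
  then show ?thesis using assms by (simp add: pl_dl_left L_group aL_inv)
qed

text \<open>The third factor of axiom (4) has the form appearing in the definition of
  \<open>actH\<close>, because the Peiffer commutator in it is \<open>dl (pl z x')\<close>.\<close>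

lemma pl_mult_right':
  assumes "z \<in> carrier H" "x \<in> carrier H" "x' \<in> carrier H"
  shows "pl z (x \<odot> x') = pl z x \<otimes> (aH (bd z) x \<rhd> pl z x')"
  using assms by (simp add: actH_def dl_pl_comm pl_mult_right L_group)

text \<open>Naturality of the interchanger: changing the second argument along \<open>m\<close>
  changes the lifting by \<open>m\<close> transported along the two ways around the square.\<close>

lemma pl_natural_right:
  assumes "x \<in> carrier H" "m \<in> carrier L" "z \<in> carrier H"
  shows "pl x (dl m \<odot> z) = (x \<rhd> m) \<otimes> pl x z \<otimes> inv (aL (bd x) m)"
proof -
  have "aH (bd x) (dl m) \<rhd> pl x z = aL (bd x) m \<otimes> pl x z \<otimes> inv (aL (bd x) m)"
    using act_dl[of "aL (bd x) m" "pl x z"] assms by simp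
  then show ?thesis
    using assms by (simp add: pl_mult_right' pl_dl_right L_group)
qed

text \<open>Axiom (3) with its conjugate rewritten as \<open>dl (pl x' z)\<close> times
  \<open>aH (bd x') z\<close>. Naturality then produces an inverse that cancels the last factor of
  the axiom.\<close>

lemma pl_mult_left':
  assumes "x \<in> carrier H" "x' \<in> carrier H" "z \<in> carrier H"
  shows "pl (x \<odot> x') z = (x \<rhd> pl x' z) \<otimes> pl x (aH (bd x') z)"
proof -
  have "x' \<odot> z \<odot> inv\<^bsub>H\<^esub> x' = dl (pl x' z) \<odot> aH (bd x') z"
    using assms by (simp add: dl_pl aH_inv H_group)
  then show ?thesis
    using assms by (simp add: pl_mult_left pl_natural_right L_group)
qed

lemma pl_natural_left:
  assumes "x \<in> carrier H" "m \<in> carrier L" "z \<in> carrier H"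
  shows "pl (dl m \<odot> x) z = m \<otimes> pl x z \<otimes> inv (aH (bd x) z \<rhd> m)"
  using assms by (simp add: pl_mult_left' act_dl pl_dl_left L_group)

end

section \<open>The cocycle identity of a 5-simplex\<close>

context two_crossed_module_loc
begin

text \<open>The word under the delta function on L in the state sum. Colours are curried functions
  of ordered vertices, so that the algebra is independent of how simplices are encoded.\<close>

definition curv :: "('v \<Rightarrow> 'v \<Rightarrow> 'g) \<Rightarrow> ('v \<Rightarrow> 'v \<Rightarrow> 'v \<Rightarrow> 'h) \<Rightarrow> ('v \<Rightarrow> 'v \<Rightarrow> 'v \<Rightarrow> 'v \<Rightarrow> 'l) \<Rightarrow>
    'v \<Rightarrow> 'v \<Rightarrow> 'v \<Rightarrow> 'v \<Rightarrow> 'v \<Rightarrow> 'l" where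
  "curv g h l a b c d e =
     inv (l a c d e) \<otimes> (h a c e \<rhd> pl (h c d e) (aH (g d e \<cdot> g c d) (h a b c)))
     \<otimes> inv (l a b c e) \<otimes> (h a b e \<rhd> l b c d e) \<otimes> l a b d e \<otimes> (h a d e \<rhd> aL (g d e) (l a b c d))"


lemma slide_dl:
  "m \<in> carrier L \<Longrightarrow> x \<in> carrier H \<Longrightarrow> y \<in> carrier L \<Longrightarrow> m \<otimes> (x \<rhd> y) = (dl m \<odot> x \<rhd> y) \<otimes> m"
  by (simp add: act_dl_mult L_group)

text \<open>The hypothesis \<open>eq\<close> is the relation of a tetrahedron coloured
  \<open>m\<close>. Both sides come from the lifting of \<open>z\<close> against the whole product,
  split before or after \<open>m\<close> is pulled out.\<close>

lemma inv_pl_natural_right: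
  assumes [simp]: "z \<in> carrier H" "x \<in> carrier H" "x' \<in> carrier H" "w \<in> carrier H" "w' \<in> carrier H" "m \<in> carrier L"
    and eq: "x \<odot> x' = dl m \<odot> w \<odot> w'"
  shows "(aH (bd z) x \<rhd> inv (pl z x')) \<otimes> (inv (pl z x) \<otimes> (z \<rhd> m))
    = aL (bd z) m \<otimes> ((aH (bd z) w \<rhd> inv (pl z w')) \<otimes> inv (pl z w))"
proof -
  have "(aH (bd z) x \<rhd> inv (pl z x')) \<otimes> (inv (pl z x) \<otimes> (z \<rhd> m)) = inv (pl z (x \<odot> x')) \<otimes> (z \<rhd> m)"
    by (simp add: pl_mult_right' act_inv L_group)
  also have "\<dots> = aL (bd z) m \<otimes> inv (pl z (w \<odot> w'))"
    unfolding eq using pl_natural_right[of z m "w \<odot> w'"] by (simp add: L_group H.m_assoc)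
  finally show ?thesis by (simp add: pl_mult_right' act_inv L_group)
qed

text \<open>The mirror image of \<open>inv_pl_natural_right\<close>, with the tetrahedron relation
  in the first argument.\<close>

lemma inv_pl_natural_left:
  assumes [simp]: "w \<in> carrier H" "x \<in> carrier H" "x' \<in> carrier H" "y \<in> carrier H" "y' \<in> carrier H" "m \<in> carrier L"
    and eq: "x \<odot> x' = dl m \<odot> y \<odot> y'"
  shows "(aH (bd x) (aH (bd x') w) \<rhd> m) \<otimes> (inv (pl y (aH (bd y') w)) \<otimes> (y \<rhd> inv (pl y' w)))
    = inv (pl x (aH (bd x') w)) \<otimes> ((x \<rhd> inv (pl x' w)) \<otimes> m)"
proof -
  have "bd (x \<odot> x') = bd (y \<odot> y')" unfolding eq by simp
  \<comment> \<open>\<open>bd\<close> does not see \<open>dl m\<close>, so both sides of the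
    tetrahedron relation transport \<open>w\<close> alike.\<close>
  then have bd: "aH (bd x) (aH (bd x') w) = aH (bd (y \<odot> y')) w" by (simp flip: aH_act)
  have "inv (pl y (aH (bd y') w)) \<otimes> (y \<rhd> inv (pl y' w)) = inv (pl (y \<odot> y') w)"
    by (simp add: pl_mult_left' act_inv L_group)
  moreover have "inv (pl x (aH (bd x') w)) \<otimes> ((x \<rhd> inv (pl x' w)) \<otimes> m) = inv (pl (x \<odot> x') w) \<otimes> m"
    by (simp add: pl_mult_left' act_inv L_group)
  moreover have "inv (pl (x \<odot> x') w) \<otimes> m = (aH (bd (y \<odot> y')) w \<rhd> m) \<otimes> inv (pl (y \<odot> y') w)"
    unfolding eq using pl_natural_left[of "y \<odot> y'" m w] by (simp add: L_group H.m_assoc)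
  ultimately show ?thesis unfolding bd by simp
qed

end

text \<open>The data present while a tetrahedron colour is still being sought;
  \<open>coloured_simplex\<close> adds flat tetrahedra.\<close>

locale coloured_triangles = two_crossed_module_loc G H L bd dl aH aL pl
  for G :: "('g, 'a) monoid_scheme" and H :: "('h, 'b) monoid_scheme"
    and L :: "('l, 'c) monoid_scheme" (structure)
    and bd dl aH aL pl +
  fixes V :: "'v::linorder set"
    and g :: "'v \<Rightarrow> 'v \<Rightarrow> 'g" and h :: "'v \<Rightarrow> 'v \<Rightarrow> 'v \<Rightarrow> 'h"
  assumes g_closed [simp]: "\<lbrakk>a \<in> V; b \<in> V; a < b\<rbrakk> \<Longrightarrow> g a b \<in> carrier G"
    and h_closed [simp]: "\<lbrakk>a \<in> V; b \<in> V; c \<in> V; a < b; b < c\<rbrakk> \<Longrightarrow> h a b c \<in> carrier H"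
    and tri: "\<lbrakk>a \<in> V; b \<in> V; c \<in> V; a < b; b < c\<rbrakk> \<Longrightarrow> bd (h a b c) \<cdot> g b c \<cdot> g a b = g a c"
begin

lemma aH_tri:
  assumes "a \<in> V" "b \<in> V" "c \<in> V" "a < b" "b < c" "x \<in> carrier H"
  shows "aH (bd (h a b c)) (aH (g b c) (aH (g a b) x)) = aH (g a c) x"
proof -
  have [simp]: "a < c" using assms by order
  show ?thesis using assms by (simp flip: aH_act tri G.m_assoc)
qed

end

locale coloured_simplex = coloured_triangles G H L bd dl aH aL pl V g h
  for G :: "('g, 'a) monoid_scheme" and H :: "('h, 'b) monoid_scheme"
    and L :: "('l, 'c) monoid_scheme" (structure)
    and bd dl aH aL pl and V :: "'v::linorder set" and g h +
  fixes l :: "'v \<Rightarrow> 'v \<Rightarrow> 'v \<Rightarrow> 'v \<Rightarrow> 'l"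
  assumes l_closed [simp]: "\<lbrakk>a \<in> V; b \<in> V; c \<in> V; d \<in> V; a < b; b < c; c < d\<rbrakk> \<Longrightarrow> l a b c d \<in> carrier L"
    and dl_l: "\<lbrakk>a \<in> V; b \<in> V; c \<in> V; d \<in> V; a < b; b < c; c < d\<rbrakk> \<Longrightarrow>
       dl (l a b c d) = h a b d \<odot> h b c d \<odot> inv\<^bsub>H\<^esub> (aH (g c d) (h a b c)) \<odot> inv\<^bsub>H\<^esub> (h a c d)"
begin

lemma tet:
  assumes "a \<in> V" "b \<in> V" "c \<in> V" "d \<in> V" "a < b" "b < c" "c < d"
  shows "h a b d \<odot> h b c d = dl (l a b c d) \<odot> h a c d \<odot> aH (g c d) (h a b c)"
proof -
  have [simp]: "a < c" "b < d" "a < d" using assms by order+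
  show ?thesis using assms by (simp add: dl_l H_group)
qed

text \<open>Under \<open>dl\<close> the word collapses, since the relations of the five tetrahedra
  telescope around the boundary of the 4-simplex. In \<open>hexagon\<close> the curvature is the
  discrepancy between two composites, with three tetrahedra on one side and two tetrahedra and an
  interchanger on the other.\<close>

lemma
  assumes V [simp]: "a \<in> V" "b \<in> V" "c \<in> V" "d \<in> V" "e \<in> V" and lt [simp]: "a < b" "b < c" "c < d" "d < e"
  shows curv_closed: "curv g h l a b c d e \<in> carrier L"
    and dl_curv: "dl (curv g h l a b c d e) = \<one>\<^bsub>H\<^esub>"
    and hexagon: "(h a b e \<rhd> l b c d e) \<otimes> (l a b d e \<otimes> (h a d e \<rhd> aL (g d e) (l a b c d)))
     = l a b c e \<otimes> ((h a c e \<rhd> inv (pl (h c d e) (aH (g d e) (aH (g c d) (h a b c)))))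
        \<otimes> (l a c d e \<otimes> curv g h l a b c d e))"
proof -
  have [simp]: "a < c" "b < d" "c < e" "a < d" "b < e" "a < e" using lt by order+
  show "curv g h l a b c d e \<in> carrier L" by (simp add: curv_def)
  show "dl (curv g h l a b c d e) = \<one>\<^bsub>H\<^esub>"
    by (simp add: curv_def dl_act dl_l dl_pl aH_act aH_mult aH_inv aH_tri H_group)
  show "(h a b e \<rhd> l b c d e) \<otimes> (l a b d e \<otimes> (h a d e \<rhd> aL (g d e) (l a b c d)))
     = l a b c e \<otimes> ((h a c e \<rhd> inv (pl (h c d e) (aH (g d e) (aH (g c d) (h a b c)))))
        \<otimes> (l a c d e \<otimes> curv g h l a b c d e))"
    by (simp add: curv_def aH_act act_inv L_group)
qed

lemma curv_central:
  assumes "a \<in> V" "b \<in> V" "c \<in> V" "d \<in> V" "e \<in> V" "a < b" "b < c" "c < d" "d < e" "z \<in> carrier L"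
  shows "curv g h l a b c d e \<otimes> z = z \<otimes> curv g h l a b c d e"
  using assms by (intro dl_ker_central) (simp_all add: curv_closed dl_curv)

lemma curv_act:
  assumes "a \<in> V" "b \<in> V" "c \<in> V" "d \<in> V" "e \<in> V" "a < b" "b < c" "c < d" "d < e" "x \<in> carrier H"
  shows "x \<rhd> curv g h l a b c d e = curv g h l a b c d e"
  using assms by (intro dl_ker_act) (simp_all add: curv_closed dl_curv)

text \<open>A tetrahedron colour may pass an element acted on by one side of its relation, at the
  price of switching to the other side.\<close>

lemma slide_tet:
  assumes "a \<in> V" "b \<in> V" "c \<in> V" "d \<in> V" "a < b" "b < c" "c < d" "y \<in> carrier L"
  shows "l a b c d \<otimes> (h a c d \<odot> aH (g c d) (h a b c) \<rhd> y) = (h a b d \<odot> h b c d \<rhd> y) \<otimes> l a b c d"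
proof -
  have [simp]: "a < c" "b < d" "a < d" using assms by order+
  show ?thesis using assms by (simp add: slide_dl tet H.m_assoc)
qed

lemma curv_cocycle:
  assumes V [simp]: "a \<in> V" "b \<in> V" "c \<in> V" "d \<in> V" "e \<in> V" "f \<in> V"
    and lt [simp]: "a < b" "b < c" "c < d" "d < e" "e < f"
  shows "aL (g e f) (curv g h l a b c d e) \<otimes> curv g h l a b c e f \<otimes> curv g h l a c d e f
       = curv g h l b c d e f \<otimes> curv g h l a b d e f \<otimes> curv g h l a b c d f"
proof -
  have [simp]: "a < c" "b < d" "c < e" "d < f" "a < d" "b < e" "c < f" "a < e" "b < f" "a < f"
    using lt by order+
  note [simp] = curv_closed
  \<comment> \<open>The names below stand for tetrahedron colours and inverse liftings, carried to a
    common base by the actions. A primed name differs from the unprimed one only in that the acting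
    element is the other side of a tetrahedron relation.\<close>
  define w where "w = aH (g e f) (aH (g d e) (aH (g c d) (h a b c)))"
  define c0 where "c0 = aL (g e f) (curv g h l a b c d e)"
  define p1 where "p1 = h a b f \<odot> h b c f \<rhd> l c d e f"
  define p2 where "p2 = h a b f \<rhd> l b c e f"
  define A1 where "A1 = h a e f \<odot> aH (g e f) (h a b e) \<rhd> aL (g e f) (l b c d e)"
  define A1' where "A1' = h a b f \<odot> h b e f \<rhd> aL (g e f) (l b c d e)"
  define A2 where "A2 = h a e f \<rhd> aL (g e f) (l a b d e)"
  define A3 where "A3 = h a e f \<odot> aH (g e f) (h a d e) \<rhd> aL (g e f) (aL (g d e) (l a b c d))"
  define A3' where "A3' = h a d f \<odot> h d e f \<rhd> aL (g e f) (aL (g d e) (l a b c d))"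
  define B1 where "B1 = h a e f \<rhd> aL (g e f) (l a b c e)"
  define B2 where "B2 = h a e f \<odot> aH (g e f) (h a c e) \<rhd> inv (pl (aH (g e f) (h c d e)) w)"
  define B2' where "B2' = h a c f \<odot> h c e f \<rhd> inv (pl (aH (g e f) (h c d e)) w)"
  define B3 where "B3 = h a e f \<rhd> aL (g e f) (l a c d e)"
  define Q1 where "Q1 = h a b f \<rhd> l b c d f"
  define Q2 where "Q2 = h a b f \<odot> h b d f \<rhd> inv (pl (h d e f) (aH (g e f) (aH (g d e) (h b c d))))"
  define Q2' where "Q2' = h a d f \<odot> aH (g d f) (h a b d) \<rhd> inv (pl (h d e f) (aH (g e f) (aH (g d e) (h b c d))))"
  define Q3 where "Q3 = h a b f \<rhd> l b d e f"
  define R2 where "R2 = h a d f \<rhd> inv (pl (h d e f) (aH (g e f) (aH (g d e) (h a b d))))"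
  define S1 where "S1 = h a d f \<rhd> aL (g d f) (l a b c d)"
  define S2 where "S2 = h a d f \<odot> aH (g d f) (h a c d) \<rhd> inv (pl (h d e f) w)"
  define S2' where "S2' = h a c f \<odot> h c d f \<rhd> inv (pl (h d e f) w)"
  define S3 where "S3 = h a d f \<rhd> inv (pl (h d e f) (aH (g e f) (aH (g d e) (h a c d))))"
  define T2 where "T2 = h a c f \<rhd> inv (pl (h c d f) (aH (g d f) (aH (g c d) (h a b c))))"
  define U2 where "U2 = h a c f \<rhd> inv (pl (h c e f) (aH (g e f) (aH (g c e) (h a b c))))"
  define W where "W = h a c f \<rhd> l c d e f"
  define p1' where "p1' = h a c f \<odot> aH (g c f) (h a b c) \<rhd> l c d e f"
  note defs = p1_def p2_def A1_def A1'_def A2_def A3_def A3'_def B1_def B2_def B2'_def B3_def Q1_def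
    Q2_def Q2'_def Q3_def R2_def S1_def S2_def S2'_def S3_def T2_def U2_def W_def p1'_def
  have [simp]: "w \<in> carrier H" unfolding w_def by simp
  have [simp]: "c0 \<in> carrier L" unfolding c0_def by simp
  have C [simp]: "p1 \<in> carrier L" "p2 \<in> carrier L" "A1 \<in> carrier L" "A1' \<in> carrier L" "A2 \<in> carrier L"
    "A3 \<in> carrier L" "A3' \<in> carrier L" "B1 \<in> carrier L" "B2 \<in> carrier L" "B2' \<in> carrier L"
    "B3 \<in> carrier L" "Q1 \<in> carrier L" "Q2 \<in> carrier L" "Q2' \<in> carrier L" "Q3 \<in> carrier L"
    "R2 \<in> carrier L" "S1 \<in> carrier L" "S2 \<in> carrier L" "S2' \<in> carrier L" "S3 \<in> carrier L"
    "T2 \<in> carrier L" "U2 \<in> carrier L" "W \<in> carrier L" "p1' \<in> carrier L"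
    by (simp_all add: defs)
  have c0: "x \<rhd> c0 = c0" if "x \<in> carrier H" for x
    using that by (simp add: c0_def dl_ker_act dl_curv)
  \<comment> \<open>The facet without \<open>f\<close> must be carried to the base by
    \<open>g e f\<close> and \<open>h a e f\<close>. H acts trivially on the kernel of
    \<open>dl\<close> but G need not, which is why only this curvature enters the identity with an
    action.\<close>
  have e1: "A1 \<otimes> (A2 \<otimes> A3) = B1 \<otimes> (B2 \<otimes> (B3 \<otimes> c0))"
    using arg_cong[OF hexagon[of a b c d e], of "\<lambda>x. h a e f \<rhd> aL (g e f) x"]
    by (simp add: aL_mult act_mult aL_actH aL_inv aL_pl act_act c0 defs flip: c0_def w_def)
  have e3: "p1 \<otimes> (p2 \<otimes> A1') = Q1 \<otimes> (Q2 \<otimes> (Q3 \<otimes> curv g h l b c d e f))"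
    using arg_cong[OF hexagon[of b c d e f], of "\<lambda>x. h a b f \<rhd> x"]
    by (simp add: act_mult curv_act act_act defs)
  have e4: "Q3 \<otimes> (l a b e f \<otimes> A2) = l a b d f \<otimes> (R2 \<otimes> (l a d e f \<otimes> curv g h l a b d e f))"
    using hexagon[of a b d e f] by (simp flip: defs)
  have e8: "Q1 \<otimes> (l a b d f \<otimes> S1) = l a b c f \<otimes> (T2 \<otimes> (l a c d f \<otimes> curv g h l a b c d f))"
    using hexagon[of a b c d f] by (simp flip: defs)
  have e10: "p2 \<otimes> (l a b e f \<otimes> B1) = l a b c f \<otimes> (U2 \<otimes> (l a c e f \<otimes> curv g h l a b c e f))"
    using hexagon[of a b c e f] by (simp flip: defs)
  have e14: "W \<otimes> (l a c e f \<otimes> B3) = l a c d f \<otimes> (S3 \<otimes> (l a d e f \<otimes> curv g h l a c d e f))"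
    using hexagon[of a c d e f] by (simp flip: defs)
  have e2: "l a b e f \<otimes> A1 = A1' \<otimes> l a b e f" unfolding defs by (rule slide_tet) simp_all
  have e5: "l a b d f \<otimes> Q2' = Q2 \<otimes> l a b d f" unfolding defs by (rule slide_tet) simp_all
  have e6: "l a d e f \<otimes> A3 = A3' \<otimes> l a d e f" unfolding defs by (rule slide_tet) simp_all
  have e9: "l a c d f \<otimes> S2 = S2' \<otimes> l a c d f" unfolding defs by (rule slide_tet) simp_all
  have e11: "l a b c f \<otimes> p1' = p1 \<otimes> l a b c f" unfolding defs by (rule slide_tet) simp_all
  have e12: "l a c e f \<otimes> B2 = B2' \<otimes> l a c e f" unfolding defs by (rule slide_tet) simp_all
  \<comment> \<open>Interchange of the triangle def with the tetrahedron abcd, transported along the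
    edges de and ef.\<close>
  have e7: "Q2' \<otimes> (R2 \<otimes> A3') = S1 \<otimes> (S2 \<otimes> S3)"
  proof -
    have *: "aH (bd (h d e f)) (aH (g e f) (aH (g d e) x)) = aH (g d f) x" if "x \<in> carrier H" for x
      using that by (simp add: aH_tri)
    have **: "aL (bd (h d e f)) (aL (g e f) (aL (g d e) x)) = aL (g d f) x" if "x \<in> carrier L" for x
      using that by (simp flip: aL_act tri[of d e f] G.m_assoc)
    have "aH (g e f) (aH (g d e) (h a b d)) \<odot> aH (g e f) (aH (g d e) (h b c d))
       = dl (aL (g e f) (aL (g d e) (l a b c d))) \<odot> aH (g e f) (aH (g d e) (h a c d)) \<odot> w"
      by (simp add: w_def tet flip: aH_mult)
    from inv_pl_natural_right[OF _ _ _ _ _ _ this, of "h d e f"]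
    show ?thesis by (simp add: * ** defs act_act flip: act_mult)
  qed
  \<comment> \<open>Interchange of the tetrahedron cdef with the transported triangle abc, whose
    colour is \<open>w\<close>.\<close>
  have e13: "p1' \<otimes> (U2 \<otimes> B2') = T2 \<otimes> (S2' \<otimes> W)"
  proof -
    have [simp]: "aH (bd (h d e f)) w = aH (g d f) (aH (g c d) (h a b c))"
      "aH (bd (h c d f)) (aH (g d f) (aH (g c d) (h a b c))) = aH (g c f) (h a b c)"
      by (simp_all add: w_def aH_tri)
    have [simp]: "aH (bd (aH (g e f) (h c d e))) w = aH (g e f) (aH (g c e) (h a b c))"
    proof -
      have "aH (bd (aH (g e f) (h c d e))) w =
          aH (g e f \<cdot> bd (h c d e) \<cdot> inv\<^bsub>G\<^esub> (g e f) \<cdot> g e f) (aH (g d e) (aH (g c d) (h a b c)))"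
        by (simp add: w_def bd_aH aH_act)
      also have "\<dots> = aH (g e f) (aH (g c e) (h a b c))"
        by (simp add: G.m_assoc aH_act aH_tri)
      finally show ?thesis .
    qed
    from inv_pl_natural_left[OF _ _ _ _ _ _ tet[of c d e f], of w]
    show ?thesis by (simp add: defs act_act flip: act_mult)
  qed
  \<comment> \<open>Evaluate p1 p2 l(abef) A1 A2 A3 in two ways: replacing A1 A2 A3 last or first. These are the two
    ways around the three-dimensional associahedron, whose pentagons are the six hexagon equations
    and whose squares are the naturality equations of the Peiffer lifting.\<close>
  define c1 where "c1 = curv g h l b c d e f"
  define c2 where "c2 = curv g h l a b d e f"
  define c3 where "c3 = curv g h l a b c d f"
  define c4 where "c4 = curv g h l a b c e f"
  define c5 where "c5 = curv g h l a c d e f"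
  have [simp]: "c1 \<in> carrier L" "c2 \<in> carrier L" "c3 \<in> carrier L" "c4 \<in> carrier L" "c5 \<in> carrier L"
    by (simp_all add: c1_def c2_def c3_def c4_def c5_def)
  have central: "c1 \<otimes> x = x \<otimes> c1" "c2 \<otimes> x = x \<otimes> c2" "c3 \<otimes> x = x \<otimes> c3"
    "c4 \<otimes> x = x \<otimes> c4" "c5 \<otimes> x = x \<otimes> c5" if "x \<in> carrier L" for x
    using that by (simp_all add: c1_def c2_def c3_def c4_def c5_def curv_central)
  \<comment> \<open>Words are right-nested, so an equation is applied inside a word in a version
    with an arbitrary tail \<open>u\<close>. In \<open>tail4\<close> the central factor
    \<open>k\<close> moves behind the tail, so that curvatures collect at the end.\<close>
  have tail2: "x \<otimes> (y \<otimes> u) = z \<otimes> (w \<otimes> u)" if "x \<otimes> y = z \<otimes> w" "x \<in> carrier L" "y \<in> carrier L"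
    "z \<in> carrier L" "w \<in> carrier L" "u \<in> carrier L" for x y z w u
    using that by (metis L.m_assoc)
  have tail3: "x \<otimes> (y \<otimes> (y' \<otimes> u)) = z \<otimes> (w \<otimes> (w' \<otimes> u))" if "x \<otimes> (y \<otimes> y') = z \<otimes> (w \<otimes> w')"
    "x \<in> carrier L" "y \<in> carrier L" "y' \<in> carrier L"
    "z \<in> carrier L" "w \<in> carrier L" "w' \<in> carrier L" "u \<in> carrier L" for x y y' z w w' u
    using that by (metis L.m_assoc L.m_closed)
  have tail4: "x \<otimes> (y \<otimes> (y' \<otimes> u)) = z \<otimes> (w \<otimes> (w' \<otimes> (u \<otimes> k)))" if "x \<otimes> (y \<otimes> y') = z \<otimes> (w \<otimes> (w' \<otimes> k))"
    "\<And>u. u \<in> carrier L \<Longrightarrow> k \<otimes> u = u \<otimes> k"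
    "x \<in> carrier L" "y \<in> carrier L" "y' \<in> carrier L" "k \<in> carrier L"
    "z \<in> carrier L" "w \<in> carrier L" "w' \<in> carrier L" "u \<in> carrier L" for x y y' z w w' u k
    using arg_cong[OF that(1), of "\<lambda>x. x \<otimes> u"] that(2-) by (simp add: L.m_assoc)
  \<comment> \<open>The vertex of the diagram where both routes end; cancelling it leaves an
    equation between curvatures.\<close>
  let ?D = "l a b c f \<otimes> (T2 \<otimes> (S2' \<otimes> (l a c d f \<otimes> (S3 \<otimes> l a d e f))))"
  have "p1 \<otimes> (p2 \<otimes> (l a b e f \<otimes> (A1 \<otimes> (A2 \<otimes> A3)))) = p1 \<otimes> (p2 \<otimes> (A1' \<otimes> (l a b e f \<otimes> (A2 \<otimes> A3))))"
    by (simp add: tail2[OF e2])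
  also have "\<dots> = Q1 \<otimes> (Q2 \<otimes> (Q3 \<otimes> (l a b e f \<otimes> (A2 \<otimes> (A3 \<otimes> c1)))))"
    by (simp add: tail4[OF e3[folded c1_def] central(1)] L.m_assoc)
  also have "\<dots> = Q1 \<otimes> (Q2 \<otimes> (l a b d f \<otimes> (R2 \<otimes> (l a d e f \<otimes> (A3 \<otimes> (c1 \<otimes> c2))))))"
    by (simp add: tail4[OF e4[folded c2_def] central(2)] L.m_assoc)
  also have "\<dots> = Q1 \<otimes> (l a b d f \<otimes> (Q2' \<otimes> (R2 \<otimes> (A3' \<otimes> (l a d e f \<otimes> (c1 \<otimes> c2))))))"
    by (simp add: tail2[OF e5] tail2[OF e6])
  also have "\<dots> = Q1 \<otimes> (l a b d f \<otimes> (S1 \<otimes> (S2 \<otimes> (S3 \<otimes> (l a d e f \<otimes> (c1 \<otimes> c2))))))"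
    by (simp add: tail3[OF e7])
  also have "\<dots> = l a b c f \<otimes> (T2 \<otimes> (l a c d f \<otimes> (S2 \<otimes> (S3 \<otimes> (l a d e f \<otimes> (c1 \<otimes> c2 \<otimes> c3))))))"
    by (simp add: tail4[OF e8[folded c3_def] central(3)] L.m_assoc)
  also have "\<dots> = ?D \<otimes> (c1 \<otimes> c2 \<otimes> c3)"
    by (simp add: tail2[OF e9] L.m_assoc)
  finally have l: "p1 \<otimes> (p2 \<otimes> (l a b e f \<otimes> (A1 \<otimes> (A2 \<otimes> A3)))) = ?D \<otimes> (c1 \<otimes> c2 \<otimes> c3)" .
  have "p1 \<otimes> (p2 \<otimes> (l a b e f \<otimes> (A1 \<otimes> (A2 \<otimes> A3)))) = p1 \<otimes> (p2 \<otimes> (l a b e f \<otimes> (B1 \<otimes> (B2 \<otimes> (B3 \<otimes> c0)))))"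
    by (simp only: e1)
  also have "\<dots> = p1 \<otimes> (l a b c f \<otimes> (U2 \<otimes> (l a c e f \<otimes> (B2 \<otimes> (B3 \<otimes> (c0 \<otimes> c4))))))"
    by (simp add: tail4[OF e10[folded c4_def] central(4)] L.m_assoc)
  also have "\<dots> = l a b c f \<otimes> (p1' \<otimes> (U2 \<otimes> (B2' \<otimes> (l a c e f \<otimes> (B3 \<otimes> (c0 \<otimes> c4))))))"
    by (simp add: tail2[OF e11] tail2[OF e12])
  also have "\<dots> = l a b c f \<otimes> (T2 \<otimes> (S2' \<otimes> (W \<otimes> (l a c e f \<otimes> (B3 \<otimes> (c0 \<otimes> c4))))))"
    by (simp add: tail3[OF e13])
  also have "\<dots> = ?D \<otimes> (c0 \<otimes> c4 \<otimes> c5)"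
    by (simp add: tail4[OF e14[folded c5_def] central(5)] L.m_assoc)
  finally have "?D \<otimes> (c0 \<otimes> c4 \<otimes> c5) = ?D \<otimes> (c1 \<otimes> c2 \<otimes> c3)" using l by simp
  then have "c0 \<otimes> c4 \<otimes> c5 = c1 \<otimes> c2 \<otimes> c3" by simp
  then show ?thesis by (simp add: c0_def c1_def c2_def c3_def c4_def c5_def)
qed
end

section \<open>Horn fillers\<close>

text \<open>\<open>Q\<close> will be the equation of T, which alone determines the solution;
  \<open>P\<close>, the flatness of the new face, then only has to be checked for that
  solution.\<close>

lemma ex1_solveI:
  assumes "s \<in> S" "P s" "Q s" "\<And>x. x \<in> S \<Longrightarrow> Q x \<Longrightarrow> x = s"
  shows "\<exists>!x. x \<in> S \<and> P x \<and> Q x"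
  using assms by blast

lemma (in group) mult_inv_eq_one_iff:
  assumes "x \<in> carrier G" "y \<in> carrier G"
  shows "x \<otimes> inv y = \<one> \<longleftrightarrow> x = y" "inv y \<otimes> x = \<one> \<longleftrightarrow> x = y"
  using assms by (metis inv_closed inv_inv inv_equality r_inv, metis inv_closed inv_inv inv_equality l_inv)

context two_crossed_module_loc
begin

lemma G_cancel: "x \<in> carrier G \<Longrightarrow> y \<in> carrier G \<Longrightarrow> x \<cdot> (inv\<^bsub>G\<^esub> x \<cdot> y) = y"
  "x \<in> carrier G \<Longrightarrow> y \<in> carrier G \<Longrightarrow> inv\<^bsub>G\<^esub> x \<cdot> (x \<cdot> y) = y"
  by (simp_all flip: G.m_assoc)
lemmas G_group = G.m_assoc G_cancel G.inv_mult_group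

lemma aH_cancel:
  assumes "x \<in> carrier G" "y \<in> carrier H"
  shows "aH x (aH (inv\<^bsub>G\<^esub> x) y) = y" "aH (inv\<^bsub>G\<^esub> x) (aH x y) = y"
  using assms by (simp_all flip: aH_act)
lemma aL_cancel:
  assumes "x \<in> carrier G" "y \<in> carrier L"
  shows "aL x (aL (inv\<^bsub>G\<^esub> x) y) = y" "aL (inv\<^bsub>G\<^esub> x) (aL x y) = y"
  using assms by (simp_all flip: aL_act)
lemma act_cancel:
  assumes "x \<in> carrier H" "y \<in> carrier L"
  shows "x \<rhd> inv\<^bsub>H\<^esub> x \<rhd> y = y" "inv\<^bsub>H\<^esub> x \<rhd> x \<rhd> y = y"
  using assms by (simp_all flip: act_act)

lemma tri_iff:
  assumes "hh \<in> carrier H" "x \<in> carrier G" "y \<in> carrier G" "z \<in> carrier G"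
  shows "bd hh \<cdot> y \<cdot> x \<cdot> inv\<^bsub>G\<^esub> z = \<one>\<^bsub>G\<^esub> \<longleftrightarrow> bd hh \<cdot> y \<cdot> x = z"
  using assms by (simp add: G.mult_inv_eq_one_iff)

lemma tet_iff:
  assumes [simp]: "y \<in> carrier L" "habd \<in> carrier H" "hbcd \<in> carrier H" "hacd \<in> carrier H" "habc \<in> carrier H" "gcd' \<in> carrier G"
  shows "dl y \<odot> hacd \<odot> aH gcd' habc \<odot> inv\<^bsub>H\<^esub> hbcd \<odot> inv\<^bsub>H\<^esub> habd = \<one>\<^bsub>H\<^esub>
    \<longleftrightarrow> dl y = habd \<odot> hbcd \<odot> inv\<^bsub>H\<^esub> (aH gcd' habc) \<odot> inv\<^bsub>H\<^esub> hacd" (is "?l = _ \<longleftrightarrow> _ = ?r")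
proof -
  have "?l = dl y \<odot> inv\<^bsub>H\<^esub> ?r" by (simp add: H_group)
  also have "\<dots> = \<one>\<^bsub>H\<^esub> \<longleftrightarrow> dl y = ?r"
    by (rule H.mult_inv_eq_one_iff) simp_all
  finally show ?thesis .
qed

lemma tet_iff':
  assumes [simp]: "y \<in> carrier L" "habd \<in> carrier H" "hbcd \<in> carrier H" "hacd \<in> carrier H" "habc \<in> carrier H" "gcd' \<in> carrier G"
  shows "dl y \<odot> hacd \<odot> aH gcd' habc \<odot> inv\<^bsub>H\<^esub> hbcd \<odot> inv\<^bsub>H\<^esub> habd = \<one>\<^bsub>H\<^esub>
    \<longleftrightarrow> dl y \<odot> hacd \<odot> aH gcd' habc = habd \<odot> hbcd" (is "?l = _ \<longleftrightarrow> ?k = ?r")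
proof -
  have "?l = ?k \<odot> inv\<^bsub>H\<^esub> ?r" by (simp add: H_group)
  also have "\<dots> = \<one>\<^bsub>H\<^esub> \<longleftrightarrow> ?k = ?r"
    by (rule H.mult_inv_eq_one_iff) simp_all
  finally show ?thesis .
qed

lemma fill_edges:
  assumes [simp]: "hh \<in> carrier H" "x \<in> carrier G" "y \<in> carrier G"
  shows "\<exists>!z. z \<in> carrier G \<and> bd hh \<cdot> y \<cdot> x \<cdot> inv\<^bsub>G\<^esub> z = \<one>\<^bsub>G\<^esub>"
    and "\<exists>!z. z \<in> carrier G \<and> bd hh \<cdot> z \<cdot> x \<cdot> inv\<^bsub>G\<^esub> y = \<one>\<^bsub>G\<^esub>"
    and "\<exists>!z. z \<in> carrier G \<and> bd hh \<cdot> x \<cdot> z \<cdot> inv\<^bsub>G\<^esub> y = \<one>\<^bsub>G\<^esub>"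
proof -
  show "\<exists>!z. z \<in> carrier G \<and> bd hh \<cdot> y \<cdot> x \<cdot> inv\<^bsub>G\<^esub> z = \<one>\<^bsub>G\<^esub>"
    by (intro ex1I[of _ "bd hh \<cdot> y \<cdot> x"]) (auto simp: tri_iff)
  show "\<exists>!z. z \<in> carrier G \<and> bd hh \<cdot> z \<cdot> x \<cdot> inv\<^bsub>G\<^esub> y = \<one>\<^bsub>G\<^esub>"
    by (intro ex1I[of _ "inv\<^bsub>G\<^esub> (bd hh) \<cdot> y \<cdot> inv\<^bsub>G\<^esub> x"]) (auto simp: tri_iff, simp_all add: G_group)
  show "\<exists>!z. z \<in> carrier G \<and> bd hh \<cdot> x \<cdot> z \<cdot> inv\<^bsub>G\<^esub> y = \<one>\<^bsub>G\<^esub>"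
    by (intro ex1I[of _ "inv\<^bsub>G\<^esub> (bd hh \<cdot> x) \<cdot> y"]) (auto simp: tri_iff, simp_all add: G_group)
qed

text \<open>Each triangle occurs once in the tetrahedron equation, so it can be isolated; for abc
  the action of the edge cd is undone as well. Applying \<open>bd\<close> to the solution makes the
  flatness conditions of the other three triangles telescope to that of the fourth.\<close>

lemma fill_triangles:
  assumes [simp]: "y \<in> carrier L" "gab \<in> carrier G" "gac \<in> carrier G" "gad \<in> carrier G" "gbc \<in> carrier G"
    "gbd \<in> carrier G" "gcd' \<in> carrier G" "habc \<in> carrier H" "habd \<in> carrier H" "hacd \<in> carrier H" "hbcd \<in> carrier H"
  defines "t \<equiv> \<lambda>hh x y z. bd hh \<cdot> y \<cdot> x \<cdot> inv\<^bsub>G\<^esub> z = \<one>\<^bsub>G\<^esub>"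
  defines "T \<equiv> \<lambda>habc habd hacd hbcd.
    dl y \<odot> hacd \<odot> aH gcd' habc \<odot> inv\<^bsub>H\<^esub> hbcd \<odot> inv\<^bsub>H\<^esub> habd = \<one>\<^bsub>H\<^esub>"
  shows "t habc gab gbc gac \<Longrightarrow> t habd gab gbd gad \<Longrightarrow> t hacd gac gcd' gad \<Longrightarrow>
      \<exists>!x. x \<in> carrier H \<and> t x gbc gcd' gbd \<and> T habc habd hacd x"
    and "t habc gab gbc gac \<Longrightarrow> t habd gab gbd gad \<Longrightarrow> t hbcd gbc gcd' gbd \<Longrightarrow>
      \<exists>!x. x \<in> carrier H \<and> t x gac gcd' gad \<and> T habc habd x hbcd"
    and "t habc gab gbc gac \<Longrightarrow> t hacd gac gcd' gad \<Longrightarrow> t hbcd gbc gcd' gbd \<Longrightarrow>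
      \<exists>!x. x \<in> carrier H \<and> t x gab gbd gad \<and> T habc x hacd hbcd"
    and "t habd gab gbd gad \<Longrightarrow> t hacd gac gcd' gad \<Longrightarrow> t hbcd gbc gcd' gbd \<Longrightarrow>
      \<exists>!x. x \<in> carrier H \<and> t x gab gbc gac \<and> T x habd hacd hbcd"
proof -
  \<comment> \<open>In this form the known triangles can be substituted, and flatness of the new one
    becomes a free-group identity in G.\<close>
  have t: "t hh x y z \<longleftrightarrow> bd hh = z \<cdot> inv\<^bsub>G\<^esub> x \<cdot> inv\<^bsub>G\<^esub> y"
    if [simp]: "hh \<in> carrier H" "x \<in> carrier G" "y \<in> carrier G" "z \<in> carrier G" for hh x y z
    unfolding t_def tri_iff[OF that] by (auto simp: G_group)
  show "\<exists>!x. x \<in> carrier H \<and> t x gbc gcd' gbd \<and> T habc habd hacd x"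
    if "t habc gab gbc gac" "t habd gab gbd gad" "t hacd gac gcd' gad"
  proof (rule ex1_solveI)
    show "t (inv\<^bsub>H\<^esub> habd \<odot> (dl y \<odot> hacd \<odot> aH gcd' habc)) gbc gcd' gbd"
      using that by (simp add: t bd_aH G_group)
    show "T habc habd hacd (inv\<^bsub>H\<^esub> habd \<odot> (dl y \<odot> hacd \<odot> aH gcd' habc))"
      by (simp add: T_def tet_iff' aH_mult aH_inv aH_cancel H_group)
    fix x assume [simp]: "x \<in> carrier H" and "T habc habd hacd x"
    then have e: "dl y \<odot> hacd \<odot> aH gcd' habc = habd \<odot> x"
      by (simp add: T_def tet_iff')
    show "x = inv\<^bsub>H\<^esub> habd \<odot> (dl y \<odot> hacd \<odot> aH gcd' habc)"
      unfolding e by (simp add: aH_mult aH_inv aH_cancel H_group)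
  qed simp
  show "\<exists>!x. x \<in> carrier H \<and> t x gac gcd' gad \<and> T habc habd x hbcd"
    if "t habc gab gbc gac" "t habd gab gbd gad" "t hbcd gbc gcd' gbd"
  proof (rule ex1_solveI)
    show "t (inv\<^bsub>H\<^esub> (dl y) \<odot> (habd \<odot> hbcd) \<odot> inv\<^bsub>H\<^esub> (aH gcd' habc)) gac gcd' gad"
      using that by (simp add: t bd_aH G_group)
    show "T habc habd (inv\<^bsub>H\<^esub> (dl y) \<odot> (habd \<odot> hbcd) \<odot> inv\<^bsub>H\<^esub> (aH gcd' habc)) hbcd"
      by (simp add: T_def tet_iff' aH_mult aH_inv aH_cancel H_group)
    fix x assume [simp]: "x \<in> carrier H" and "T habc habd x hbcd"
    then have e: "dl y \<odot> x \<odot> aH gcd' habc = habd \<odot> hbcd"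
      by (simp add: T_def tet_iff')
    show "x = inv\<^bsub>H\<^esub> (dl y) \<odot> (habd \<odot> hbcd) \<odot> inv\<^bsub>H\<^esub> (aH gcd' habc)"
      unfolding e[symmetric] by (simp add: aH_mult aH_inv aH_cancel H_group)
  qed simp
  show "\<exists>!x. x \<in> carrier H \<and> t x gab gbd gad \<and> T habc x hacd hbcd"
    if "t habc gab gbc gac" "t hacd gac gcd' gad" "t hbcd gbc gcd' gbd"
  proof (rule ex1_solveI)
    show "t ((dl y \<odot> hacd \<odot> aH gcd' habc) \<odot> inv\<^bsub>H\<^esub> hbcd) gab gbd gad"
      using that by (simp add: t bd_aH G_group)
    show "T habc ((dl y \<odot> hacd \<odot> aH gcd' habc) \<odot> inv\<^bsub>H\<^esub> hbcd) hacd hbcd"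
      by (simp add: T_def tet_iff' aH_mult aH_inv aH_cancel H_group)
    fix x assume [simp]: "x \<in> carrier H" and "T habc x hacd hbcd"
    then have e: "dl y \<odot> hacd \<odot> aH gcd' habc = x \<odot> hbcd"
      by (simp add: T_def tet_iff')
    show "x = (dl y \<odot> hacd \<odot> aH gcd' habc) \<odot> inv\<^bsub>H\<^esub> hbcd"
      unfolding e by (simp add: aH_mult aH_inv aH_cancel H_group)
  qed simp
  show "\<exists>!x. x \<in> carrier H \<and> t x gab gbc gac \<and> T x habd hacd hbcd"
    if "t habd gab gbd gad" "t hacd gac gcd' gad" "t hbcd gbc gcd' gbd"
  proof (rule ex1_solveI)
    show "t (aH (inv\<^bsub>G\<^esub> gcd') (inv\<^bsub>H\<^esub> hacd \<odot> inv\<^bsub>H\<^esub> (dl y) \<odot> (habd \<odot> hbcd))) gab gbc gac"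
      using that by (simp add: t bd_aH G_group)
    show "T (aH (inv\<^bsub>G\<^esub> gcd') (inv\<^bsub>H\<^esub> hacd \<odot> inv\<^bsub>H\<^esub> (dl y) \<odot> (habd \<odot> hbcd))) habd hacd hbcd"
      by (simp add: T_def tet_iff' aH_mult aH_inv aH_cancel H_group)
    fix x assume [simp]: "x \<in> carrier H" and "T x habd hacd hbcd"
    then have e: "dl y \<odot> hacd \<odot> aH gcd' x = habd \<odot> hbcd"
      by (simp add: T_def tet_iff')
    show "x = aH (inv\<^bsub>G\<^esub> gcd') (inv\<^bsub>H\<^esub> hacd \<odot> inv\<^bsub>H\<^esub> (dl y) \<odot> (habd \<odot> hbcd))"
      unfolding e[symmetric] by (simp add: aH_mult aH_inv aH_cancel H_group)
  qed simp
qed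

end

context coloured_triangles
begin

text \<open>The holonomy around the four triangles of a tetrahedron: flatness says that
  \<open>dl\<close> of its colour takes this value.\<close>

definition tet_bd :: "'v \<Rightarrow> 'v \<Rightarrow> 'v \<Rightarrow> 'v \<Rightarrow> 'h" where
  "tet_bd a b c d = h a b d \<odot> h b c d \<odot> inv\<^bsub>H\<^esub> (aH (g c d) (h a b c)) \<odot> inv\<^bsub>H\<^esub> (h a c d)"

text \<open>The condition that \<open>curv\<close> be trivial, with the tetrahedra as unknowns:
  \<open>x1\<close> to \<open>x5\<close> colour the faces opposite \<open>a\<close> to
  \<open>e\<close>.\<close>

definition hex where
  "hex a b c d e x1 x2 x3 x4 x5 \<longleftrightarrow>
    inv x2 \<otimes> (h a c e \<rhd> pl (h c d e) (aH (g d e \<cdot> g c d) (h a b c)))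
     \<otimes> inv x4 \<otimes> (h a b e \<rhd> x1) \<otimes> x3 \<otimes> (h a d e \<rhd> aL (g d e) x5) = \<one>"

lemma hex_iff:
  assumes [simp]: "a \<in> V" "b \<in> V" "c \<in> V" "d \<in> V" "e \<in> V" and lt [simp]: "a < b" "b < c" "c < d" "d < e"
    and [simp]: "x1 \<in> carrier L" "x2 \<in> carrier L" "x3 \<in> carrier L" "x4 \<in> carrier L" "x5 \<in> carrier L"
  shows "hex a b c d e x1 x2 x3 x4 x5 \<longleftrightarrow>
     (h a b e \<rhd> x1) \<otimes> x3 \<otimes> (h a d e \<rhd> aL (g d e) x5)
     = x4 \<otimes> inv (h a c e \<rhd> pl (h c d e) (aH (g d e) (aH (g c d) (h a b c)))) \<otimes> x2" (is "_ \<longleftrightarrow> ?l = ?r")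
proof -
  have [simp]: "a < c" "b < d" "c < e" "a < d" "b < e" "a < e" using lt by order+
  have "hex a b c d e x1 x2 x3 x4 x5 \<longleftrightarrow> inv ?r \<otimes> ?l = \<one>"
    by (simp add: hex_def aH_act L_group)
  also have "\<dots> \<longleftrightarrow> ?l = ?r"
    by (rule L.mult_inv_eq_one_iff) simp_all
  finally show ?thesis .
qed

text \<open>As for triangles: every tetrahedron occurs once, and the actions on \<open>x1\<close>
  and \<open>x5\<close> are invertible. The flatness of the solution is the telescoping behind
  \<open>dl_curv\<close>, read as a formula for one of the five boundaries.\<close>

lemma fill_tetrahedra:
  assumes [simp]: "a \<in> V" "b \<in> V" "c \<in> V" "d \<in> V" "e \<in> V" and lt [simp]: "a < b" "b < c" "c < d" "d < e"
    and [simp]: "x1 \<in> carrier L" "x2 \<in> carrier L" "x3 \<in> carrier L" "x4 \<in> carrier L" "x5 \<in> carrier L"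
  shows "dl x2 = tet_bd a c d e \<Longrightarrow> dl x3 = tet_bd a b d e \<Longrightarrow> dl x4 = tet_bd a b c e \<Longrightarrow> dl x5 = tet_bd a b c d \<Longrightarrow>
    \<exists>!x. x \<in> carrier L \<and> dl x = tet_bd b c d e \<and> hex a b c d e x x2 x3 x4 x5"
   and "dl x1 = tet_bd b c d e \<Longrightarrow> dl x3 = tet_bd a b d e \<Longrightarrow> dl x4 = tet_bd a b c e \<Longrightarrow> dl x5 = tet_bd a b c d \<Longrightarrow>
    \<exists>!x. x \<in> carrier L \<and> dl x = tet_bd a c d e \<and> hex a b c d e x1 x x3 x4 x5"
   and "dl x1 = tet_bd b c d e \<Longrightarrow> dl x2 = tet_bd a c d e \<Longrightarrow> dl x4 = tet_bd a b c e \<Longrightarrow> dl x5 = tet_bd a b c d \<Longrightarrow>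
    \<exists>!x. x \<in> carrier L \<and> dl x = tet_bd a b d e \<and> hex a b c d e x1 x2 x x4 x5"
   and "dl x1 = tet_bd b c d e \<Longrightarrow> dl x2 = tet_bd a c d e \<Longrightarrow> dl x3 = tet_bd a b d e \<Longrightarrow> dl x5 = tet_bd a b c d \<Longrightarrow>
    \<exists>!x. x \<in> carrier L \<and> dl x = tet_bd a b c e \<and> hex a b c d e x1 x2 x3 x x5"
   and "dl x1 = tet_bd b c d e \<Longrightarrow> dl x2 = tet_bd a c d e \<Longrightarrow> dl x3 = tet_bd a b d e \<Longrightarrow> dl x4 = tet_bd a b c e \<Longrightarrow>
    \<exists>!x. x \<in> carrier L \<and> dl x = tet_bd a b c d \<and> hex a b c d e x1 x2 x3 x4 x"
proof -
  have [simp]: "a < c" "b < d" "c < e" "a < d" "b < e" "a < e" using lt by order+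
  let ?y = "h a c e \<rhd> pl (h c d e) (aH (g d e) (aH (g c d) (h a b c)))"
  let ?X1 = "h a b e \<rhd> x1" and ?X5 = "h a d e \<rhd> aL (g d e) x5"
  note D = tet_bd_def dl_act dl_pl aH_mult aH_inv aH_tri H_group aH_cancel
  note S = hex_iff L_group act_mult act_inv act_cancel aL_cancel
  show "\<exists>!x. x \<in> carrier L \<and> dl x = tet_bd b c d e \<and> hex a b c d e x x2 x3 x4 x5"
    if d: "dl x2 = tet_bd a c d e" "dl x3 = tet_bd a b d e" "dl x4 = tet_bd a b c e" "dl x5 = tet_bd a b c d"
  proof (rule ex1_solveI)
    show "dl (inv\<^bsub>H\<^esub> (h a b e) \<rhd> ((x4 \<otimes> inv ?y \<otimes> x2) \<otimes> inv ?X5 \<otimes> inv x3)) = tet_bd b c d e"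
      by (simp add: d D)
    fix x assume [simp]: "x \<in> carrier L" and "hex a b c d e x x2 x3 x4 x5"
    then have e: "(h a b e \<rhd> x) \<otimes> x3 \<otimes> ?X5 = (x4 \<otimes> inv ?y \<otimes> x2)"
      by (simp add: hex_iff)
    show "x = inv\<^bsub>H\<^esub> (h a b e) \<rhd> ((x4 \<otimes> inv ?y \<otimes> x2) \<otimes> inv ?X5 \<otimes> inv x3)"
      unfolding e[symmetric] by (simp add: S)
  qed (simp_all add: S)
  show "\<exists>!x. x \<in> carrier L \<and> dl x = tet_bd a c d e \<and> hex a b c d e x1 x x3 x4 x5"
    if d: "dl x1 = tet_bd b c d e" "dl x3 = tet_bd a b d e" "dl x4 = tet_bd a b c e" "dl x5 = tet_bd a b c d"
  proof (rule ex1_solveI)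
    show "dl (?y \<otimes> inv x4 \<otimes> (?X1 \<otimes> x3 \<otimes> ?X5)) = tet_bd a c d e"
      by (simp add: d D)
    fix x assume [simp]: "x \<in> carrier L" and "hex a b c d e x1 x x3 x4 x5"
    then have e: "(?X1 \<otimes> x3 \<otimes> ?X5) = x4 \<otimes> inv ?y \<otimes> x"
      by (simp add: hex_iff)
    show "x = ?y \<otimes> inv x4 \<otimes> (?X1 \<otimes> x3 \<otimes> ?X5)"
      unfolding e by (simp add: S)
  qed (simp_all add: S)
  show "\<exists>!x. x \<in> carrier L \<and> dl x = tet_bd a b d e \<and> hex a b c d e x1 x2 x x4 x5"
    if d: "dl x1 = tet_bd b c d e" "dl x2 = tet_bd a c d e" "dl x4 = tet_bd a b c e" "dl x5 = tet_bd a b c d"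
  proof (rule ex1_solveI)
    show "dl (inv ?X1 \<otimes> (x4 \<otimes> inv ?y \<otimes> x2) \<otimes> inv ?X5) = tet_bd a b d e"
      by (simp add: d D)
    fix x assume [simp]: "x \<in> carrier L" and "hex a b c d e x1 x2 x x4 x5"
    then have e: "?X1 \<otimes> x \<otimes> ?X5 = (x4 \<otimes> inv ?y \<otimes> x2)"
      by (simp add: hex_iff)
    show "x = inv ?X1 \<otimes> (x4 \<otimes> inv ?y \<otimes> x2) \<otimes> inv ?X5"
      unfolding e[symmetric] by (simp add: S)
  qed (simp_all add: S)
  show "\<exists>!x. x \<in> carrier L \<and> dl x = tet_bd a b c e \<and> hex a b c d e x1 x2 x3 x x5"
    if d: "dl x1 = tet_bd b c d e" "dl x2 = tet_bd a c d e" "dl x3 = tet_bd a b d e" "dl x5 = tet_bd a b c d"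
  proof (rule ex1_solveI)
    show "dl ((?X1 \<otimes> x3 \<otimes> ?X5) \<otimes> inv x2 \<otimes> ?y) = tet_bd a b c e"
      by (simp add: d D)
    fix x assume [simp]: "x \<in> carrier L" and "hex a b c d e x1 x2 x3 x x5"
    then have e: "(?X1 \<otimes> x3 \<otimes> ?X5) = x \<otimes> inv ?y \<otimes> x2"
      by (simp add: hex_iff)
    show "x = (?X1 \<otimes> x3 \<otimes> ?X5) \<otimes> inv x2 \<otimes> ?y"
      unfolding e by (simp add: S)
  qed (simp_all add: S)
  show "\<exists>!x. x \<in> carrier L \<and> dl x = tet_bd a b c d \<and> hex a b c d e x1 x2 x3 x4 x"
    if d: "dl x1 = tet_bd b c d e" "dl x2 = tet_bd a c d e" "dl x3 = tet_bd a b d e" "dl x4 = tet_bd a b c e"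
  proof (rule ex1_solveI)
    show "dl (aL (inv\<^bsub>G\<^esub> (g d e)) (inv\<^bsub>H\<^esub> (h a d e) \<rhd> (inv x3 \<otimes> inv ?X1 \<otimes> (x4 \<otimes> inv ?y \<otimes> x2)))) = tet_bd a b c d"
      by (simp add: d D)
    fix x assume [simp]: "x \<in> carrier L" and "hex a b c d e x1 x2 x3 x4 x"
    then have e: "?X1 \<otimes> x3 \<otimes> (h a d e \<rhd> aL (g d e) x) = (x4 \<otimes> inv ?y \<otimes> x2)"
      by (simp add: hex_iff)
    show "x = aL (inv\<^bsub>G\<^esub> (g d e)) (inv\<^bsub>H\<^esub> (h a d e) \<rhd> (inv x3 \<otimes> inv ?X1 \<otimes> (x4 \<otimes> inv ?y \<otimes> x2)))"
      unfolding e[symmetric] by (simp add: S)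
  qed (simp_all add: S)
qed

end

section \<open>Simplices as increasing lists of vertices\<close>

lemma vx_eq: "sorted xs \<Longrightarrow> distinct xs \<Longrightarrow> vx (set xs) i = xs ! i"
  by (simp add: vx_def sorted_list_of_set.idem_if_sorted_distinct)

lemma vx_2: "a < b \<Longrightarrow> vx {a,b} 0 = a \<and> vx {a,b} 1 = b"
  using vx_eq[of "[a,b]"] by simp
lemma vx_3: "a < b \<Longrightarrow> b < c \<Longrightarrow> vx {a,b,c} 0 = a \<and> vx {a,b,c} 1 = b \<and> vx {a,b,c} 2 = c"
  using vx_eq[of "[a,b,c]"] by (simp add: numeral_2_eq_2)
lemma vx_4: "a < b \<Longrightarrow> b < c \<Longrightarrow> c < d \<Longrightarrow>
    vx {a,b,c,d} 0 = a \<and> vx {a,b,c,d} 1 = b \<and> vx {a,b,c,d} 2 = c \<and> vx {a,b,c,d} 3 = d"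
  using vx_eq[of "[a,b,c,d]"] by (simp add: numeral_2_eq_2 numeral_3_eq_3)
lemma vx_5: "a < b \<Longrightarrow> b < c \<Longrightarrow> c < d \<Longrightarrow> d < e \<Longrightarrow>
    vx {a,b,c,d,e} 0 = a \<and> vx {a,b,c,d,e} 1 = b \<and> vx {a,b,c,d,e} 2 = c \<and> vx {a,b,c,d,e} 3 = d \<and> vx {a,b,c,d,e} 4 = e"
  using vx_eq[of "[a,b,c,d,e]"] by (simp add: eval_nat_numeral)

lemma set_eq_2_iff: "a < b \<Longrightarrow> a' < b' \<Longrightarrow> {a,b} = {a',b'} \<longleftrightarrow> a = a' \<and> b = b'" for a b :: nat
  by (metis vx_2)
lemma set_eq_3_iff: "a < b \<Longrightarrow> b < c \<Longrightarrow> a' < b' \<Longrightarrow> b' < c' \<Longrightarrow>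
    {a,b,c} = {a',b',c'} \<longleftrightarrow> a = a' \<and> b = b' \<and> c = c'" for a b c :: nat
  by (metis vx_3)
lemma set_eq_4_iff: "a < b \<Longrightarrow> b < c \<Longrightarrow> c < d \<Longrightarrow> a' < b' \<Longrightarrow> b' < c' \<Longrightarrow> c' < d' \<Longrightarrow>
    {a,b,c,d} = {a',b',c',d'} \<longleftrightarrow> a = a' \<and> b = b' \<and> c = c' \<and> d = d'" for a b c d :: nat
  by (metis vx_4)
lemma set_eq_5_iff: "a < b \<Longrightarrow> b < c \<Longrightarrow> c < d \<Longrightarrow> d < e \<Longrightarrow> a' < b' \<Longrightarrow> b' < c' \<Longrightarrow> c' < d' \<Longrightarrow> d' < e' \<Longrightarrow>
    {a,b,c,d,e} = {a',b',c',d',e'} \<longleftrightarrow> a = a' \<and> b = b' \<and> c = c' \<and> d = d' \<and> e = e'" for a b c d e :: nat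
  by (metis vx_5)

lemma card_sorted [simp]:
  fixes a b c d e f :: nat
  shows "a < b \<Longrightarrow> card {a,b} = 2"
    and "a < b \<Longrightarrow> b < c \<Longrightarrow> card {a,b,c} = 3"
    and "a < b \<Longrightarrow> b < c \<Longrightarrow> c < d \<Longrightarrow> card {a,b,c,d} = 4"
    and "a < b \<Longrightarrow> b < c \<Longrightarrow> c < d \<Longrightarrow> d < e \<Longrightarrow> card {a,b,c,d,e} = 5"
    and "a < b \<Longrightarrow> b < c \<Longrightarrow> c < d \<Longrightarrow> d < e \<Longrightarrow> e < f \<Longrightarrow> card {a,b,c,d,e,f} = 6"
  by simp_all

lemma sorted_set_cases:
  fixes T :: "nat set"
  assumes "card T = n" "0 < n"
  obtains xs where "T = set xs" "sorted_wrt (<) xs" "length xs = n"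
  using assms that[of "sorted_list_of_set T"] by (metis card_gt_0_iff length_sorted_list_of_set set_sorted_list_of_set strict_sorted_list_of_set)

lemma card_3_cases:
  fixes T :: "nat set" assumes "card T = 3"
  obtains a b c where "T = {a,b,c}" "a < b" "b < c"
proof -
  obtain xs where "T = set xs" "sorted_wrt (<) xs" "length xs = 3" using sorted_set_cases[OF assms] by auto
  then show thesis using that by (auto simp: length_Suc_conv eval_nat_numeral)
qed
lemma card_4_cases:
  fixes T :: "nat set" assumes "card T = 4"
  obtains a b c d where "T = {a,b,c,d}" "a < b" "b < c" "c < d"
proof -
  obtain xs where "T = set xs" "sorted_wrt (<) xs" "length xs = 4" using sorted_set_cases[OF assms] by auto
  then show thesis using that by (auto simp: length_Suc_conv eval_nat_numeral)
qed
lemma card_5_cases: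
  fixes T :: "nat set" assumes "card T = 5"
  obtains a b c d e where "T = {a,b,c,d,e}" "a < b" "b < c" "c < d" "d < e"
proof -
  obtain xs where "T = set xs" "sorted_wrt (<) xs" "length xs = 5" using sorted_set_cases[OF assms] by auto
  then show thesis using that by (auto simp: length_Suc_conv eval_nat_numeral)
qed
lemma card_6_cases:
  fixes T :: "nat set" assumes "card T = 6"
  obtains a b c d e f where "T = {a,b,c,d,e,f}" "a < b" "b < c" "c < d" "d < e" "e < f"
proof -
  obtain xs where "T = set xs" "sorted_wrt (<) xs" "length xs = 6" using sorted_set_cases[OF assms] by auto
  then show thesis using that by (auto simp: length_Suc_conv eval_nat_numeral)
qed

section \<open>Unique horn filling for colourings indexed by vertex sets\<close>

context two_crossed_module_loc
begin

text \<open>A simplex of any dimension carries a triple whose irrelevant components are \<open>undefined\<close>, so that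
  edges, triangles and tetrahedra are treated uniformly.\<close>
definition cols :: "nat set \<Rightarrow> ('g \<times> 'h \<times> 'l) set" where
  "cols s = (if card s = 2 then carrier G else {undefined}) \<times>
     (if card s = 3 then carrier H else {undefined}) \<times> (if card s = 4 then carrier L else {undefined})"

definition gc :: "(nat set \<Rightarrow> 'g \<times> 'h \<times> 'l) \<Rightarrow> nat \<Rightarrow> nat \<Rightarrow> 'g" where
  "gc c x y = fst (c {x,y})"
definition hc :: "(nat set \<Rightarrow> 'g \<times> 'h \<times> 'l) \<Rightarrow> nat \<Rightarrow> nat \<Rightarrow> nat \<Rightarrow> 'h" where
  "hc c x y z = fst (snd (c {x,y,z}))"
definition lc :: "(nat set \<Rightarrow> 'g \<times> 'h \<times> 'l) \<Rightarrow> nat \<Rightarrow> nat \<Rightarrow> nat \<Rightarrow> nat \<Rightarrow> 'l" where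
  "lc c x y z w = snd (snd (c {x,y,z,w}))"

definition flat_tri where
  "flat_tri g h x y z \<longleftrightarrow> bd (h x y z) \<cdot> g y z \<cdot> g x y \<cdot> inv\<^bsub>G\<^esub> (g x z) = \<one>\<^bsub>G\<^esub>"
definition flat_tet where
  "flat_tet g h l x y z w \<longleftrightarrow> dl (l x y z w) \<odot> h x z w \<odot> aH (g z w) (h x y z)
     \<odot> inv\<^bsub>H\<^esub> (h y z w) \<odot> inv\<^bsub>H\<^esub> (h x y w) = \<one>\<^bsub>H\<^esub>"

text \<open>Sets of six vertices are unconstrained and have a single colour, so the 5-simplex of a
  move can itself be added to the complex.\<close>

definition flat :: "nat set \<Rightarrow> (nat set \<Rightarrow> 'g \<times> 'h \<times> 'l) \<Rightarrow> bool" where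
  "flat s c \<longleftrightarrow>
     (card s = 3 \<longrightarrow> flat_tri (gc c) (hc c) (vx s 0) (vx s 1) (vx s 2)) \<and>
     (card s = 4 \<longrightarrow> flat_tet (gc c) (hc c) (lc c) (vx s 0) (vx s 1) (vx s 2) (vx s 3)) \<and>
     (card s = 5 \<longrightarrow> curv (gc c) (hc c) (lc c) (vx s 0) (vx s 1) (vx s 2) (vx s 3) (vx s 4) = \<one>)"

lemma flat_simps [simp]:
  shows "x < y \<Longrightarrow> y < z \<Longrightarrow> flat {x,y,z} c \<longleftrightarrow> flat_tri (gc c) (hc c) x y z"
    and "x < y \<Longrightarrow> y < z \<Longrightarrow> z < w \<Longrightarrow> flat {x,y,z,w} c \<longleftrightarrow> flat_tet (gc c) (hc c) (lc c) x y z w"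
    and "x < y \<Longrightarrow> y < z \<Longrightarrow> z < w \<Longrightarrow> w < v \<Longrightarrow> flat {x,y,z,w,v} c \<longleftrightarrow> curv (gc c) (hc c) (lc c) x y z w v = \<one>"
    and "card s \<notin> {3,4,5} \<Longrightarrow> flat s c"
  using vx_3[of x y z] vx_4[of x y z w] vx_5[of x y z w v] by (simp_all add: flat_def del: One_nat_def)

lemma upd_other [simp]:
  "x < y \<Longrightarrow> card s \<noteq> 2 \<Longrightarrow> gc (c(s := v)) x y = gc c x y"
  "x < y \<Longrightarrow> y < z \<Longrightarrow> card s \<noteq> 3 \<Longrightarrow> hc (c(s := v)) x y z = hc c x y z"
  "x < y \<Longrightarrow> y < z \<Longrightarrow> z < w \<Longrightarrow> card s \<noteq> 4 \<Longrightarrow> lc (c(s := v)) x y z w = lc c x y z w"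
  by (auto simp: gc_def hc_def lc_def)

lemma upd_same [simp]:
  "x < y \<Longrightarrow> x' < y' \<Longrightarrow> gc (c({x',y'} := v)) x y = (if x = x' \<and> y = y' then fst v else gc c x y)"
  "x < y \<Longrightarrow> y < z \<Longrightarrow> x' < y' \<Longrightarrow> y' < z' \<Longrightarrow>
    hc (c({x',y',z'} := v)) x y z = (if x = x' \<and> y = y' \<and> z = z' then fst (snd v) else hc c x y z)"
  "x < y \<Longrightarrow> y < z \<Longrightarrow> z < w \<Longrightarrow> x' < y' \<Longrightarrow> y' < z' \<Longrightarrow> z' < w' \<Longrightarrow>
    lc (c({x',y',z',w'} := v)) x y z w = (if x = x' \<and> y = y' \<and> z = z' \<and> w = w' then snd (snd v) else lc c x y z w)"
  by (auto simp: gc_def hc_def lc_def set_eq_2_iff set_eq_3_iff set_eq_4_iff simp del: insert_iff)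

lemma ex1_cols:
  "card s = 2 \<Longrightarrow> \<exists>!x. x \<in> carrier G \<and> P (x, undefined, undefined) \<Longrightarrow> \<exists>!v. v \<in> cols s \<and> P v"
  "card s = 3 \<Longrightarrow> \<exists>!x. x \<in> carrier H \<and> P (undefined, x, undefined) \<Longrightarrow> \<exists>!v. v \<in> cols s \<and> P v"
  "card s = 4 \<Longrightarrow> \<exists>!x. x \<in> carrier L \<and> P (undefined, undefined, x) \<Longrightarrow> \<exists>!v. v \<in> cols s \<and> P v"
  "card s \<notin> {2,3,4} \<Longrightarrow> P (undefined, undefined, undefined) \<Longrightarrow> \<exists>!v. v \<in> cols s \<and> P v"
  unfolding cols_def by auto

definition horn_coloured where
  "horn_coloured T u c \<longleftrightarrow> (\<forall>s. s \<subseteq> T \<longrightarrow> s \<noteq> {} \<longrightarrow> s \<noteq> T \<longrightarrow> s \<noteq> T - {u} \<longrightarrow> c s \<in> cols s \<and> flat s c)"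

lemma horn_colouredD:
  assumes "horn_coloured T u c" "s \<subseteq> T" "s \<noteq> {}" "card s < card T" "s \<noteq> T - {u}"
  shows "c s \<in> cols s" "flat s c"
  using assms unfolding horn_coloured_def by auto

lemma colsD: 
  assumes "c s \<in> cols s"
  shows "s = {x,y} \<Longrightarrow> x < y \<Longrightarrow> gc c x y \<in> carrier G"
    "s = {x,y,z} \<Longrightarrow> x < y \<Longrightarrow> y < z \<Longrightarrow> hc c x y z \<in> carrier H"
    "s = {x,y,z,w} \<Longrightarrow> x < y \<Longrightarrow> y < z \<Longrightarrow> z < w \<Longrightarrow> lc c x y z w \<in> carrier L"
  using assms by (auto simp: cols_def gc_def hc_def lc_def)

lemma horn_unique_3:
  assumes T: "T = {p,q,r}" and lt: "p < q" "q < r" and u: "u \<in> T"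
    and c: "horn_coloured T u c" and b: "b \<in> cols T"
  shows "\<exists>!a. a \<in> cols (T - {u}) \<and> flat (T - {u}) (c(T - {u} := a, T := b)) \<and> flat T (c(T - {u} := a, T := b))"
proof -
  have [simp]: "p \<noteq> q" "p \<noteq> r" "q \<noteq> r" "q \<noteq> p" "r \<noteq> p" "r \<noteq> q" "p < r" using lt by auto
  note [simp] = lt
  obtain hh where b: "b = (undefined, hh, undefined)" and [simp]: "hh \<in> carrier H"
    using b by (auto simp: cols_def T)
  have g: "gc c x y \<in> carrier G" if "{x, y} \<subseteq> T" "x < y" "{x,y} \<noteq> T - {u}" for x y
    using that horn_colouredD(1)[OF c, of "{x,y}"] by (intro colsD(1)[of _ "{x,y}"]) (auto simp: T)
  consider "u = p" | "u = q" | "u = r" using u T by auto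
  then show ?thesis
  proof cases
    case 1
    have [simp]: "{p,q,r} - {p} = {q,r}" by auto
    show ?thesis using fill_edges(2)[of hh "gc c p q" "gc c p r"] g[of p q] g[of p r]
      by (intro ex1_cols(1)) (simp_all add: T b 1 set_eq_2_iff flat_tri_def)
  next
    case 2
    have [simp]: "{p,q,r} - {q} = {p,r}" by auto
    show ?thesis using fill_edges(1)[of hh "gc c p q" "gc c q r"] g[of p q] g[of q r]
      by (intro ex1_cols(1)) (simp_all add: T b 2 set_eq_2_iff flat_tri_def)
  next
    case 3
    have [simp]: "{p,q,r} - {r} = {p,q}" by auto
    show ?thesis using fill_edges(3)[of hh "gc c q r" "gc c p r"] g[of p r] g[of q r]
      by (intro ex1_cols(1)) (simp_all add: T b 3 set_eq_2_iff flat_tri_def)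
  qed
qed

text \<open>For the facet of a 5-simplex that omits the last vertex: the cocycle identity sees its
  curvature only through this action.\<close>

lemma aL_eq_one: "x \<in> carrier G \<Longrightarrow> y \<in> carrier L \<Longrightarrow> aL x y = \<one> \<longleftrightarrow> y = \<one>"
  by (metis G.inv_closed aL_cancel(2) aL_one)

lemma horn_unique_4:
  assumes T: "T = {p,q,r,s}" and lt: "p < q" "q < r" "r < s" and u: "u \<in> T"
    and c: "horn_coloured T u c" and b: "b \<in> cols T"
  shows "\<exists>!a. a \<in> cols (T - {u}) \<and> flat (T - {u}) (c(T - {u} := a, T := b)) \<and> flat T (c(T - {u} := a, T := b))"
proof -
  have [simp]: "p \<noteq> q" "p \<noteq> r" "p \<noteq> s" "q \<noteq> p" "q \<noteq> r" "q \<noteq> s" "r \<noteq> p" "r \<noteq> q" "r \<noteq> s" "s \<noteq> p" "s \<noteq> q" "s \<noteq> r" "p < r" "p < s" "q < s"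
    using lt by auto
  note [simp] = lt
  have [simp]: "card T = 4" by (simp add: T)
  then have "finite T" by (rule_tac card_ge_0_finite) simp
  then have [simp]: "card (T - {u}) = 3" using u by simp
  have ne: "X \<noteq> T - {u}" if "card X \<noteq> 3" for X using that by auto
  have g: "gc c x y \<in> carrier G" if "{x,y} \<subseteq> T" "x < y" for x y
    using that horn_colouredD(1)[OF c, of "{x,y}"] ne[of "{x,y}"] by (intro colsD(1)[of _ "{x,y}"]) simp_all
  have h: "hc c x y z \<in> carrier H" "flat_tri (gc c) (hc c) x y z"
    if "{x,y,z} \<subseteq> T" "x < y" "y < z" "{x,y,z} \<noteq> T - {u}" for x y z
    using that horn_colouredD[OF c, of "{x,y,z}"] by (simp_all add: colsD(2)[of _ "{x,y,z}"])
  obtain ll where b: "b = (undefined, undefined, ll)" and [simp]: "ll \<in> carrier L"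
    using b by (auto simp: cols_def T)
  consider "u = p" | "u = q" | "u = r" | "u = s" using u T by auto
  then show ?thesis
  proof cases
    case 1
    have [simp]: "{p,q,r,s} - {p} = {q,r,s}" by auto
    show ?thesis
      \<comment> \<open>The unit of H stands in the slot of the missing triangle; the other cases,
        and those for tetrahedra, use a unit in the same way.\<close>
      using fill_triangles(1)[of ll "gc c p q" "gc c p r" "gc c p s" "gc c q r" "gc c q s" "gc c r s" "hc c p q r" "hc c p q s" "hc c p r s" "\<one>\<^bsub>H\<^esub>"] h[of p q r] h[of p q s] h[of p r s]
      by (intro ex1_cols(2)) (simp_all add: T b 1 g set_eq_3_iff flat_tri_def flat_tet_def)
  next
    case 2
    have [simp]: "{p,q,r,s} - {q} = {p,r,s}" by auto
    show ?thesis
      using fill_triangles(2)[of ll "gc c p q" "gc c p r" "gc c p s" "gc c q r" "gc c q s" "gc c r s" "hc c p q r" "hc c p q s" "\<one>\<^bsub>H\<^esub>" "hc c q r s"] h[of p q r] h[of p q s] h[of q r s]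
      by (intro ex1_cols(2)) (simp_all add: T b 2 g set_eq_3_iff flat_tri_def flat_tet_def)
  next
    case 3
    have [simp]: "{p,q,r,s} - {r} = {p,q,s}" by auto
    show ?thesis
      using fill_triangles(3)[of ll "gc c p q" "gc c p r" "gc c p s" "gc c q r" "gc c q s" "gc c r s" "hc c p q r" "\<one>\<^bsub>H\<^esub>" "hc c p r s" "hc c q r s"] h[of p q r] h[of p r s] h[of q r s]
      by (intro ex1_cols(2)) (simp_all add: T b 3 g set_eq_3_iff flat_tri_def flat_tet_def)
  next
    case 4
    have [simp]: "{p,q,r,s} - {s} = {p,q,r}" by auto
    show ?thesis
      using fill_triangles(4)[of ll "gc c p q" "gc c p r" "gc c p s" "gc c q r" "gc c q s" "gc c r s" "\<one>\<^bsub>H\<^esub>" "hc c p q s" "hc c p r s" "hc c q r s"] h[of p q s] h[of p r s] h[of q r s]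
      by (intro ex1_cols(2)) (simp_all add: T b 4 g set_eq_3_iff flat_tri_def flat_tet_def)
  qed
qed

lemma horn_unique_5:
  assumes T: "T = {p,q,r,s,t}" and lt: "p < q" "q < r" "r < s" "s < t" and u: "u \<in> T"
    and c: "horn_coloured T u c" and b: "b \<in> cols T"
  shows "\<exists>!a. a \<in> cols (T - {u}) \<and> flat (T - {u}) (c(T - {u} := a, T := b)) \<and> flat T (c(T - {u} := a, T := b))"
proof -
  have [simp]: "p \<noteq> q" "p \<noteq> r" "p \<noteq> s" "p \<noteq> t" "q \<noteq> p" "q \<noteq> r" "q \<noteq> s" "q \<noteq> t" "r \<noteq> p" "r \<noteq> q" "r \<noteq> s" "r \<noteq> t" "s \<noteq> p" "s \<noteq> q" "s \<noteq> r" "s \<noteq> t" "t \<noteq> p" "t \<noteq> q" "t \<noteq> r" "t \<noteq> s" "p < r" "p < s" "p < t" "q < s" "q < t" "r < t"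
    using lt by auto
  note [simp] = lt
  have [simp]: "card T = 5" by (simp add: T)
  then have "finite T" by (rule_tac card_ge_0_finite) simp
  then have [simp]: "card (T - {u}) = 4" using u by simp
  have ne: "X \<noteq> T - {u}" if "card X \<noteq> 4" for X using that by auto
  have g: "gc c x y \<in> carrier G" if "{x,y} \<subseteq> T" "x < y" for x y
    using that horn_colouredD(1)[OF c, of "{x,y}"] ne[of "{x,y}"] by (intro colsD(1)[of _ "{x,y}"]) simp_all
  have h: "hc c x y z \<in> carrier H" "flat_tri (gc c) (hc c) x y z"
    if "{x,y,z} \<subseteq> T" "x < y" "y < z" for x y z
    using that horn_colouredD[OF c, of "{x,y,z}"] ne[of "{x,y,z}"] by (simp_all add: colsD(2)[of _ "{x,y,z}"])
  have l: "lc c x y z w \<in> carrier L" "flat_tet (gc c) (hc c) (lc c) x y z w"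
    if "{x,y,z,w} \<subseteq> T" "x < y" "y < z" "z < w" "{x,y,z,w} \<noteq> T - {u}" for x y z w
    using that horn_colouredD[OF c, of "{x,y,z,w}"] by (simp_all add: colsD(3)[of _ "{x,y,z,w}"])
  have b: "b = (undefined, undefined, undefined)"
    using b by (auto simp: cols_def T)
  \<comment> \<open>The missing face is a tetrahedron, so all triangles of T belong to the horn and
    are flat.\<close>
  interpret coloured_triangles G H L bd dl aH aL pl T "gc c" "hc c"
    using h(2) by unfold_locales (simp_all add: g h(1) flat_tri_def tri_iff)
  consider "u = p" | "u = q" | "u = r" | "u = s" | "u = t" using u T by auto
  then show ?thesis
  proof cases
    case 1
    have [simp]: "{p,q,r,s,t} - {p} = {q,r,s,t}" by auto
    show ?thesis
      using fill_tetrahedra(1)[of p q r s t "\<one>" "lc c p r s t" "lc c p q s t" "lc c p q r t" "lc c p q r s"] l[of p r s t] l[of p q s t] l[of p q r t] l[of p q r s]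
      by (intro ex1_cols(3)) (simp_all add: T b 1 set_eq_4_iff curv_def hex_def flat_tet_def tet_bd_def tet_iff cong: conj_cong)
  next
    case 2
    have [simp]: "{p,q,r,s,t} - {q} = {p,r,s,t}" by auto
    show ?thesis
      using fill_tetrahedra(2)[of p q r s t "lc c q r s t" "\<one>" "lc c p q s t" "lc c p q r t" "lc c p q r s"] l[of q r s t] l[of p q s t] l[of p q r t] l[of p q r s]
      by (intro ex1_cols(3)) (simp_all add: T b 2 set_eq_4_iff curv_def hex_def flat_tet_def tet_bd_def tet_iff cong: conj_cong)
  next
    case 3
    have [simp]: "{p,q,r,s,t} - {r} = {p,q,s,t}" by auto
    show ?thesis
      using fill_tetrahedra(3)[of p q r s t "lc c q r s t" "lc c p r s t" "\<one>" "lc c p q r t" "lc c p q r s"] l[of q r s t] l[of p r s t] l[of p q r t] l[of p q r s]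
      by (intro ex1_cols(3)) (simp_all add: T b 3 set_eq_4_iff curv_def hex_def flat_tet_def tet_bd_def tet_iff cong: conj_cong)
  next
    case 4
    have [simp]: "{p,q,r,s,t} - {s} = {p,q,r,t}" by auto
    show ?thesis
      using fill_tetrahedra(4)[of p q r s t "lc c q r s t" "lc c p r s t" "lc c p q s t" "\<one>" "lc c p q r s"] l[of q r s t] l[of p r s t] l[of p q s t] l[of p q r s]
      by (intro ex1_cols(3)) (simp_all add: T b 4 set_eq_4_iff curv_def hex_def flat_tet_def tet_bd_def tet_iff cong: conj_cong)
  next
    case 5
    have [simp]: "{p,q,r,s,t} - {t} = {p,q,r,s}" by auto
    show ?thesis
      using fill_tetrahedra(5)[of p q r s t "lc c q r s t" "lc c p r s t" "lc c p q s t" "lc c p q r t" "\<one>"] l[of q r s t] l[of p r s t] l[of p q s t] l[of p q r t]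
      by (intro ex1_cols(3)) (simp_all add: T b 5 set_eq_4_iff curv_def hex_def flat_tet_def tet_bd_def tet_iff cong: conj_cong)
  qed
qed

text \<open>A 4-simplex has only one colour, so the claim is that the missing one is flat. The other
  five curvatures are trivial and drop out of the cocycle identity, which leaves the sixth.\<close>

lemma horn_unique_6:
  assumes T: "T = {p,q,r,s,t,v}" and lt: "p < q" "q < r" "r < s" "s < t" "t < v" and u: "u \<in> T"
    and c: "horn_coloured T u c" and b: "b \<in> cols T"
  shows "\<exists>!a. a \<in> cols (T - {u}) \<and> flat (T - {u}) (c(T - {u} := a, T := b)) \<and> flat T (c(T - {u} := a, T := b))"
proof -
  have [simp]: "p \<noteq> q" "p \<noteq> r" "p \<noteq> s" "p \<noteq> t" "p \<noteq> v" "q \<noteq> p" "q \<noteq> r" "q \<noteq> s" "q \<noteq> t" "q \<noteq> v" "r \<noteq> p" "r \<noteq> q" "r \<noteq> s" "r \<noteq> t" "r \<noteq> v" "s \<noteq> p" "s \<noteq> q" "s \<noteq> r" "s \<noteq> t" "s \<noteq> v" "t \<noteq> p" "t \<noteq> q" "t \<noteq> r" "t \<noteq> s" "t \<noteq> v" "v \<noteq> p" "v \<noteq> q" "v \<noteq> r" "v \<noteq> s" "v \<noteq> t" "p < r" "p < s" "p < t" "p < v" "q < s" "q < t" "q < v" "r < t" "r < v" "s < v"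
    using lt by auto
  note [simp] = lt
  have [simp]: "card T = 6" by (simp add: T)
  then have "finite T" by (rule_tac card_ge_0_finite) simp
  then have [simp]: "card (T - {u}) = 5" using u by simp
  have ne: "X \<noteq> T - {u}" if "card X \<noteq> 5" for X using that by auto
  have g: "gc c x y \<in> carrier G" if "{x,y} \<subseteq> T" "x < y" for x y
    using that horn_colouredD(1)[OF c, of "{x,y}"] ne[of "{x,y}"] by (intro colsD(1)[of _ "{x,y}"]) simp_all
  have h: "hc c x y z \<in> carrier H" "flat_tri (gc c) (hc c) x y z"
    if "{x,y,z} \<subseteq> T" "x < y" "y < z" for x y z
    using that horn_colouredD[OF c, of "{x,y,z}"] ne[of "{x,y,z}"] by (simp_all add: colsD(2)[of _ "{x,y,z}"])
  have l: "lc c x y z w \<in> carrier L" "flat_tet (gc c) (hc c) (lc c) x y z w"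
    if "{x,y,z,w} \<subseteq> T" "x < y" "y < z" "z < w" for x y z w
    using that horn_colouredD[OF c, of "{x,y,z,w}"] ne[of "{x,y,z,w}"] by (simp_all add: colsD(3)[of _ "{x,y,z,w}"])
  have k: "curv (gc c) (hc c) (lc c) x y z w w' = \<one>"
    if "{x,y,z,w,w'} \<subseteq> T" "x < y" "y < z" "z < w" "w < w'" "{x,y,z,w,w'} \<noteq> T - {u}" for x y z w w'
    using that horn_colouredD(2)[OF c, of "{x,y,z,w,w'}"] by simp
  interpret coloured_simplex G H L bd dl aH aL pl T "gc c" "hc c" "lc c"
  proof unfold_locales
    fix x y z w assume A: "x \<in> T" "y \<in> T" "z \<in> T" "w \<in> T" "x < y" "y < z" "z < w"
    then have "x < z" "y < w" "x < w" by auto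
    with A l(2)[of x y z w] show "dl (lc c x y z w) =
        hc c x y w \<odot> hc c y z w \<odot> inv\<^bsub>H\<^esub> (aH (gc c z w) (hc c x y z)) \<odot> inv\<^bsub>H\<^esub> (hc c x z w)"
      by (simp add: flat_tet_def tet_iff g h(1) l(1))
  qed (use h(2) in \<open>simp_all add: g h(1) l(1) flat_tri_def tri_iff\<close>)
  have "curv (gc c) (hc c) (lc c) q r s t v \<in> carrier L" "curv (gc c) (hc c) (lc c) p r s t v \<in> carrier L"
    "curv (gc c) (hc c) (lc c) p q s t v \<in> carrier L" "curv (gc c) (hc c) (lc c) p q r t v \<in> carrier L"
    "curv (gc c) (hc c) (lc c) p q r s v \<in> carrier L" "curv (gc c) (hc c) (lc c) p q r s t \<in> carrier L"
    by (simp_all add: curv_closed T)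
  note coc = this curv_cocycle[of p q r s t v]
  consider "u = p" | "u = q" | "u = r" | "u = s" | "u = t" | "u = v" using u T by auto
  then show ?thesis
  proof cases
    case 1
    have [simp]: "{p,q,r,s,t,v} - {p} = {q,r,s,t,v}" by auto
    have "curv (gc c) (hc c) (lc c) q r s t v = \<one>"
      using coc k[of p r s t v] k[of p q s t v] k[of p q r t v] k[of p q r s v] k[of p q r s t] by (simp add: T 1 set_eq_5_iff g)
    then show ?thesis
      by (intro ex1_cols(4)) (simp_all add: T 1 curv_def)
  next
    case 2
    have [simp]: "{p,q,r,s,t,v} - {q} = {p,r,s,t,v}" by auto
    have "curv (gc c) (hc c) (lc c) p r s t v = \<one>"
      using coc k[of q r s t v] k[of p q s t v] k[of p q r t v] k[of p q r s v] k[of p q r s t] by (simp add: T 2 set_eq_5_iff g)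
    then show ?thesis
      by (intro ex1_cols(4)) (simp_all add: T 2 curv_def)
  next
    case 3
    have [simp]: "{p,q,r,s,t,v} - {r} = {p,q,s,t,v}" by auto
    have "curv (gc c) (hc c) (lc c) p q s t v = \<one>"
      using coc k[of q r s t v] k[of p r s t v] k[of p q r t v] k[of p q r s v] k[of p q r s t] by (simp add: T 3 set_eq_5_iff g)
    then show ?thesis
      by (intro ex1_cols(4)) (simp_all add: T 3 curv_def)
  next
    case 4
    have [simp]: "{p,q,r,s,t,v} - {s} = {p,q,r,t,v}" by auto
    have "curv (gc c) (hc c) (lc c) p q r t v = \<one>"
      using coc k[of q r s t v] k[of p r s t v] k[of p q s t v] k[of p q r s v] k[of p q r s t] by (simp add: T 4 set_eq_5_iff g)
    then show ?thesis
      by (intro ex1_cols(4)) (simp_all add: T 4 curv_def)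
  next
    case 5
    have [simp]: "{p,q,r,s,t,v} - {t} = {p,q,r,s,v}" by auto
    have "curv (gc c) (hc c) (lc c) p q r s v = \<one>"
      using coc k[of q r s t v] k[of p r s t v] k[of p q s t v] k[of p q r t v] k[of p q r s t] by (simp add: T 5 set_eq_5_iff g)
    then show ?thesis
      by (intro ex1_cols(4)) (simp_all add: T 5 curv_def)
  next
    case 6
    have [simp]: "{p,q,r,s,t,v} - {v} = {p,q,r,s,t}" by auto
    have "curv (gc c) (hc c) (lc c) p q r s t = \<one>"
      using coc k[of q r s t v] k[of p r s t v] k[of p q s t v] k[of p q r t v] k[of p q r s v] by (simp add: T 6 set_eq_5_iff g aL_eq_one)
    then show ?thesis
      by (intro ex1_cols(4)) (simp_all add: T 6 curv_def)
  qed
qed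

end

section \<open>Bistellar moves and elementary expansions\<close>

definition simplicial :: "nat set set \<Rightarrow> bool" where
  "simplicial X \<longleftrightarrow> finite X \<and> (\<forall>s\<in>X. finite s \<and> s \<noteq> {}) \<and> (\<forall>s\<in>X. \<forall>t. t \<subseteq> s \<longrightarrow> t \<noteq> {} \<longrightarrow> t \<in> X)"

definition simplices :: "nat set set \<Rightarrow> nat set set" where
  "simplices K = {s. s \<noteq> {} \<and> (\<exists>F\<in>K. s \<subseteq> F)}"

lemma simplicial_simplices:
  assumes "finite K" "\<And>F. F \<in> K \<Longrightarrow> finite F"
  shows "simplicial (simplices K)"
proof -
  have "simplices K \<subseteq> (\<Union>F\<in>K. Pow F)" by (auto simp: simplices_def)
  moreover have "finite (\<Union>F\<in>K. Pow F)" using assms by auto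
  ultimately have "finite (simplices K)" by (rule finite_subset)
  moreover have "finite s" if "s \<in> simplices K" for s
    using that assms(2) unfolding simplices_def by (auto dest: finite_subset)
  moreover have "t \<in> simplices K" if "s \<in> simplices K" "t \<subseteq> s" "t \<noteq> {}" for s t
    using that unfolding simplices_def by blast
  moreover have "{} \<notin> simplices K" by (simp add: simplices_def)
  ultimately show ?thesis unfolding simplicial_def by metis
qed

text \<open>The inverse of an elementary collapse. \<open>T \<noteq> {u}\<close> keeps the free face
  nonempty: adding an isolated vertex would change the homotopy type.\<close>

definition elementary_expansion :: "nat set set \<Rightarrow> nat set \<Rightarrow> nat \<Rightarrow> bool" where
  "elementary_expansion X T u \<longleftrightarrow> T \<notin> X \<and> u \<in> T \<and> T \<noteq> {u} \<and> T - {u} \<notin> X \<and> (\<forall>v\<in>T - {u}. T - {v} \<in> X)"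

text \<open>A face of S that misses some v in A lies in the facet \<open>S - {v}\<close> of K. With
  A replaced by \<open>S - A\<close> the lemma describes the complex after the move.\<close>

lemma bistellar_simplices_Int:
  assumes "A \<subseteq> S" "\<forall>v\<in>A. S - {v} \<in> K" "\<forall>F\<in>K. \<not> A \<subseteq> F"
  shows "simplices K \<inter> Pow S = {s. s \<subseteq> S \<and> s \<noteq> {} \<and> \<not> A \<subseteq> s}"
proof
  show "simplices K \<inter> Pow S \<subseteq> {s. s \<subseteq> S \<and> s \<noteq> {} \<and> \<not> A \<subseteq> s}"
    using assms(3) by (force simp: simplices_def)
  show "{s. s \<subseteq> S \<and> s \<noteq> {} \<and> \<not> A \<subseteq> s} \<subseteq> simplices K \<inter> Pow S"
  proof
    fix s assume s: "s \<in> {s. s \<subseteq> S \<and> s \<noteq> {} \<and> \<not> A \<subseteq> s}"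
    then obtain v where "v \<in> A" "v \<notin> s" by auto
    then have "s \<subseteq> S - {v}" "S - {v} \<in> K" using s assms by auto
    then show "s \<in> simplices K \<inter> Pow S" using s by (auto simp: simplices_def)
  qed
qed

text \<open>The faces of \<open>S\<close> containing \<open>A\<close> are matched as \<open>s\<close> with \<open>insert w s\<close>; adding the pairs in order of
  increasing cardinality makes each step an elementary expansion.\<close>
lemma expansion_induct:
  assumes fin: "finite S" and A: "A \<subseteq> S" "A \<noteq> {}" and w: "w \<in> S - A"
    and X: "simplicial X" "\<And>s. s \<subseteq> S \<Longrightarrow> s \<noteq> {} \<Longrightarrow> \<not> A \<subseteq> s \<Longrightarrow> s \<in> X"
    and match: "\<And>s. A \<subseteq> s \<Longrightarrow> s \<subseteq> S - {w} \<Longrightarrow> s \<in> X \<longleftrightarrow> insert w s \<in> X"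
    and step: "\<And>X T u. simplicial X \<Longrightarrow> elementary_expansion X T u \<Longrightarrow> T \<subseteq> S \<Longrightarrow>
       (f :: nat set set \<Rightarrow> 'r) (insert T (insert (T - {u}) X)) = f X"
  shows "f (X \<union> (Pow S - {{}})) = f X"
  using X match
proof (induction "card (Pow S - {{}} - X)" arbitrary: X rule: less_induct)
  case less
  show ?case
  proof (cases "Pow S - {{}} \<subseteq> X")
    case True
    then show ?thesis by (simp add: Un_absorb2)
  next
    case False
    \<comment> \<open>The lower halves of the pairs that are still to be added.\<close>
    define M where "M = {s. A \<subseteq> s \<and> s \<subseteq> S - {w} \<and> s \<notin> X}"
    obtain t where t: "t \<subseteq> S" "t \<noteq> {}" "t \<notin> X" using False by auto
    then have At: "A \<subseteq> t" using less.prems(2) by blast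
    have "t - {w} \<in> M"
    proof -
      have "A \<subseteq> t - {w}" using At w by auto
      moreover have "t - {w} \<notin> X"
        using less.prems(3)[of "t - {w}"] t \<open>A \<subseteq> t - {w}\<close> by (cases "w \<in> t") (auto simp: insert_absorb)
      ultimately show ?thesis using t by (auto simp: M_def)
    qed
    then obtain s where s: "s \<in> M" and min: "\<And>r. r \<in> M \<Longrightarrow> card s \<le> card r"
      using arg_min_nat_lemma[of "\<lambda>s. s \<in> M" _ card] by blast
    have s': "A \<subseteq> s" "s \<subseteq> S" "w \<notin> s" "s \<notin> X" "s \<noteq> {}"
      using s A by (auto simp: M_def)
    have "finite s" using fin s'(2) by (rule rev_finite_subset)
    note s' = s' this
    let ?T = "insert w s"
    have [simp]: "?T - {w} = s" using s' by auto
    have T: "?T \<notin> X" using less.prems(3)[of s] s by (auto simp: M_def)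
    \<comment> \<open>If \<open>s - {v}\<close> still contains A, then minimality of
      \<open>s\<close> puts it into X, and its partner follows by the matching. Otherwise both sets
      miss part of A and, when nonempty, lie in X by assumption.\<close>
    have face: "s - {v} \<in> X \<or> s - {v} = {}" "insert w (s - {v}) \<in> X" if v: "v \<in> s" for v
    proof -
      have *: "s - {v} \<in> X" if "A \<subseteq> s - {v}"
      proof (rule ccontr)
        assume "s - {v} \<notin> X"
        then have "s - {v} \<in> M" using that s by (auto simp: M_def)
        then have "card s \<le> card (s - {v})" by (rule min)
        moreover have "card (s - {v}) < card s" using v s' by (intro psubset_card_mono) auto
        ultimately show False by simp
      qed
      show "s - {v} \<in> X \<or> s - {v} = {}"
        using * less.prems(2)[of "s - {v}"] s' by blast
      show "insert w (s - {v}) \<in> X"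
      proof (cases "A \<subseteq> s - {v}")
        case True
        then show ?thesis using * less.prems(3)[of "s - {v}"] s by (auto simp: M_def)
      next
        case False
        then show ?thesis using less.prems(2)[of "insert w (s - {v})"] s' w by auto
      qed
    qed
    have ex: "elementary_expansion X ?T w"
      unfolding elementary_expansion_def using T s' face(2) by (auto simp: insert_Diff_if)
    let ?X = "insert ?T (insert s X)"
    have sub: "r \<in> X" if "r \<subseteq> ?T" "r \<noteq> {}" "r \<noteq> ?T" "r \<noteq> s" for r
    proof -
      have "\<exists>v\<in>s. r \<subseteq> insert w (s - {v})" using that by blast
      then show ?thesis using face(2) that(2) less.prems(1) unfolding simplicial_def by blast
    qed
    have simp: "simplicial ?X"
      unfolding simplicial_def
    proof (intro conjI ballI allI impI)
      fix r r' assume "r \<in> ?X" "r' \<subseteq> r" "r' \<noteq> {}"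
      then show "r' \<in> ?X" using sub[of r'] less.prems(1) s' unfolding simplicial_def by blast
    qed (use less.prems(1) s' in \<open>auto simp: simplicial_def\<close>)
    have "f (?X \<union> (Pow S - {{}})) = f ?X"
    proof (rule less.hyps)
      show "card (Pow S - {{}} - ?X) < card (Pow S - {{}} - X)"
        using s' fin by (intro psubset_card_mono) auto
      show "simplicial ?X" by fact
      show "r \<in> ?X" if "r \<subseteq> S" "r \<noteq> {}" "\<not> A \<subseteq> r" for r using less.prems(2)[OF that] by simp
      \<comment> \<open>Partners enter together, so the matching survives the step.\<close>
      show "r \<in> ?X \<longleftrightarrow> insert w r \<in> ?X" if "A \<subseteq> r" "r \<subseteq> S - {w}" for r
        using less.prems(3)[OF that] that(2) s' by (auto simp: insert_eq_iff)
    qed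
    also have "f ?X = f X" using step[OF less.prems(1) ex] s' w by auto
    also have "?X \<union> (Pow S - {{}}) = X \<union> (Pow S - {{}})" using s' w by auto
    finally show ?thesis .
  qed
qed

lemma bistellar_move_invariant:
  assumes move: "bistellar_move d K K'" and fin: "finite K" "\<And>F. F \<in> K \<Longrightarrow> finite F"
    and step: "\<And>X T u. simplicial X \<Longrightarrow> elementary_expansion X T u \<Longrightarrow> card T \<le> d + 2 \<Longrightarrow>
       (f :: nat set set \<Rightarrow> 'r) (insert T (insert (T - {u}) X)) = f X"
  shows "f (simplices K) = f (simplices K')"
proof -
  obtain S A where S: "card S = d + 2" "A \<subseteq> S" "A \<noteq> {}" "A \<noteq> S" "\<forall>v\<in>A. S - {v} \<in> K"
    "\<forall>F\<in>K. S - A \<subseteq> F \<longrightarrow> (\<exists>v\<in>A. F = S - {v})" "\<forall>F\<in>K. \<not> A \<subseteq> F"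
    and K': "K' = (K - (\<lambda>v. S - {v}) ` A) \<union> (\<lambda>v. S - {v}) ` (S - A)"
    using move unfolding bistellar_move_def by blast
  have finS: "finite S" using S(1) by (intro card_ge_0_finite) simp
  have fin': "finite K'" "\<And>F. F \<in> K' \<Longrightarrow> finite F" using fin finS by (auto simp: K')
  \<comment> \<open>General in J and B in order to serve both K with A and K' with
    \<open>S - A\<close>.\<close>
  have one: "f (simplices J \<union> (Pow S - {{}})) = f (simplices J)"
    if J: "finite J" "\<And>F. F \<in> J \<Longrightarrow> finite F" and B: "B \<subseteq> S" "B \<noteq> {}" "B \<noteq> S"
      and i: "simplices J \<inter> Pow S = {s. s \<subseteq> S \<and> s \<noteq> {} \<and> \<not> B \<subseteq> s}" for J B
  proof -
    obtain w where w: "w \<in> S - B" using B by auto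
    show ?thesis
    proof (rule expansion_induct[OF finS B(1,2) w simplicial_simplices[OF J]])
      show "s \<in> simplices J" if "s \<subseteq> S" "s \<noteq> {}" "\<not> B \<subseteq> s" for s using i that by auto
      show "s \<in> simplices J \<longleftrightarrow> insert w s \<in> simplices J" if "B \<subseteq> s" "s \<subseteq> S - {w}" for s
      proof -
        \<comment> \<open>Initially no face containing B is present, so the matching holds with both
          partners absent.\<close>
        have "s \<notin> simplices J \<inter> Pow S" "insert w s \<notin> simplices J \<inter> Pow S" using that unfolding i by auto
        then show ?thesis using that w by auto
      qed
      show "f (insert T (insert (T - {u}) X)) = f X"
        if "simplicial X" "elementary_expansion X T u" "T \<subseteq> S" for X T u
        using step[OF that(1,2)] card_mono[OF finS that(3)] S(1) by simp
    qed
  qed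
  have "f (simplices K \<union> (Pow S - {{}})) = f (simplices K)"
    by (rule one[OF fin S(2,3,4) bistellar_simplices_Int[OF S(2,5,7)]])
  moreover have "f (simplices K' \<union> (Pow S - {{}})) = f (simplices K')"
  proof (rule one[OF fin', where B = "S - A"])
    show "simplices K' \<inter> Pow S = {s. s \<subseteq> S \<and> s \<noteq> {} \<and> \<not> S - A \<subseteq> s}"
      \<comment> \<open>Every facet of K containing \<open>S - A\<close> is one of those that the
        move removes, and a new facet \<open>S - {v}\<close> misses v in
        \<open>S - A\<close>.\<close>
      by (rule bistellar_simplices_Int) (use S(6) in \<open>auto simp: K'\<close>)
  qed (use S in auto)
  moreover have "simplices K \<union> (Pow S - {{}}) = simplices K' \<union> (Pow S - {{}})"
    by (auto simp: simplices_def K')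
  ultimately show ?thesis by simp
qed

section \<open>Counting flat colourings\<close>

context two_crossed_module_loc
begin

lemma horn_unique:
  assumes "card T \<in> {2..6}" "u \<in> T" "horn_coloured T u c" "b \<in> cols T"
  shows "\<exists>!a. a \<in> cols (T - {u}) \<and> flat (T - {u}) (c(T - {u} := a, T := b)) \<and> flat T (c(T - {u} := a, T := b))"
proof -
  have "finite T" using assms(1) by (intro card_ge_0_finite) auto
  then have card: "card (T - {u}) = card T - 1" using assms(2) by simp
  consider "card T = 2" | "card T = 3" | "card T = 4" | "card T = 5" | "card T = 6"
    using assms(1) by fastforce
  then show ?thesis
  proof cases
    case 1
    \<comment> \<open>The missing face is a vertex, which has one colour and no condition, whatever
      the colour of the edge.\<close>
    then show ?thesis by (intro ex1_cols(4)) (simp_all add: card)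
  next
    case 2
    then show ?thesis by (elim card_3_cases) (rule horn_unique_3[OF _ _ _ assms(2-)], assumption+)
  next
    case 3
    then show ?thesis by (elim card_4_cases) (rule horn_unique_4[OF _ _ _ _ assms(2-)], assumption+)
  next
    case 4
    then show ?thesis by (elim card_5_cases) (rule horn_unique_5[OF _ _ _ _ _ assms(2-)], assumption+)
  next
    case 5
    then show ?thesis by (elim card_6_cases) (rule horn_unique_6[OF _ _ _ _ _ _ assms(2-)], assumption+)
  qed
qed

lemma flat_cong:
  assumes "\<And>t. t \<subseteq> s \<Longrightarrow> t \<noteq> {} \<Longrightarrow> c t = c' t"
  shows "flat s c \<longleftrightarrow> flat s c'"
proof -
  have g: "gc c x y = gc c' x y" if "{x,y} \<subseteq> s" for x y
    using assms[of "{x,y}"] that by (simp add: gc_def)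
  have h: "hc c x y z = hc c' x y z" if "{x,y,z} \<subseteq> s" for x y z
    using assms[of "{x,y,z}"] that by (simp add: hc_def)
  have l: "lc c x y z w = lc c' x y z w" if "{x,y,z,w} \<subseteq> s" for x y z w
    using assms[of "{x,y,z,w}"] that by (simp add: lc_def)
  consider "card s = 3" | "card s = 4" | "card s = 5" | "card s \<notin> {3,4,5}" by auto
  then show ?thesis
  proof cases
    case 1
    then show ?thesis by (elim card_3_cases) (simp add: flat_tri_def g h)
  next
    case 2
    then show ?thesis by (elim card_4_cases) (simp add: flat_tet_def g h l)
  next
    case 3
    then show ?thesis by (elim card_5_cases) (simp add: curv_def g h l)
  qed simp
qed

definition colourings :: "nat set set \<Rightarrow> (nat set \<Rightarrow> 'g \<times> 'h \<times> 'l) set" where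
  "colourings X = {c \<in> PiE X cols. \<forall>s\<in>X. flat s c}"

text \<open>Restriction to X together with the colour of T is a bijection: injective by uniqueness
  of the filler, surjective by its existence.\<close>

lemma card_colourings_expansion:
  assumes X: "simplicial X" and ex: "elementary_expansion X T u" and card: "card T \<in> {2..6}"
  shows "card (colourings (insert T (insert (T - {u}) X))) = card (colourings X) * card (cols T)"
proof -
  let ?\<sigma> = "T - {u}"
  let ?Y = "insert T (insert ?\<sigma> X)"
  note ex = ex[unfolded elementary_expansion_def]
  have [simp]: "T \<noteq> ?\<sigma>" "?\<sigma> \<noteq> T" "T \<notin> X" "?\<sigma> \<notin> X" using ex by auto
  have down: "t \<in> X" if "s \<in> X" "t \<subseteq> s" "t \<noteq> {}" for s t using X that unfolding simplicial_def by blast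
  have horn: "s \<in> X" if "s \<subseteq> T" "s \<noteq> {}" "s \<noteq> T" "s \<noteq> ?\<sigma>" for s
  proof -
    have "\<exists>v\<in>T - {u}. s \<subseteq> T - {v}" using that by blast
    then show ?thesis using ex down that(2) by blast
  qed
  have hc: "horn_coloured T u c" if "\<And>s. s \<in> X \<Longrightarrow> c s \<in> cols s" "\<And>s. s \<in> X \<Longrightarrow> flat s c" for c
    unfolding horn_coloured_def using horn that by blast
  have flat: "flat s c \<longleftrightarrow> flat s c'" if "s \<in> X" "\<And>t. t \<in> X \<Longrightarrow> c t = c' t" for s c c'
    using that down by (intro flat_cong) blast
  let ?r = "\<lambda>c. (restrict c X, c T)"
  have "bij_betw ?r (colourings ?Y) (colourings X \<times> cols T)"
    unfolding bij_betw_def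
  proof (intro conjI inj_onI equalityI subsetI)
    fix c c' assume c: "c \<in> colourings ?Y" "c' \<in> colourings ?Y" and eq: "?r c = ?r c'"
    have eqX: "c s = c' s" if "s \<in> X" for s using eq that by (metis fst_conv restrict_apply')
    have C: "c = c(?\<sigma> := c ?\<sigma>, T := c T)" by simp
    \<comment> \<open>On the faces of T the two colourings can differ at most at the free face, so
      \<open>c'\<close> also provides a filler of the horn of \<open>c\<close>.\<close>
    have C': "flat s c' = flat s (c(?\<sigma> := c' ?\<sigma>, T := c T))" if "s \<subseteq> T" for s
      using that eq eqX horn by (intro flat_cong) auto
    have "\<exists>!a. a \<in> cols ?\<sigma> \<and> flat ?\<sigma> (c(?\<sigma> := a, T := c T)) \<and> flat T (c(?\<sigma> := a, T := c T))"
      using c by (intro horn_unique hc) (use card ex in \<open>auto simp: colourings_def\<close>)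
    moreover have "c' ?\<sigma> \<in> cols ?\<sigma> \<and> flat ?\<sigma> (c(?\<sigma> := c' ?\<sigma>, T := c T)) \<and> flat T (c(?\<sigma> := c' ?\<sigma>, T := c T))"
      using c C'[of T] C'[of ?\<sigma>] by (auto simp: colourings_def)
    moreover have "c ?\<sigma> \<in> cols ?\<sigma> \<and> flat ?\<sigma> (c(?\<sigma> := c ?\<sigma>, T := c T)) \<and> flat T (c(?\<sigma> := c ?\<sigma>, T := c T))"
      using c by (auto simp: colourings_def)
    ultimately have "c ?\<sigma> = c' ?\<sigma>" by blast
    moreover have "c \<in> extensional ?Y" "c' \<in> extensional ?Y" using c by (auto simp: colourings_def PiE_def)
    ultimately show "c = c'" using eqX eq by (intro extensionalityI[of c ?Y c']) auto
  next
    fix p assume "p \<in> ?r ` colourings ?Y"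
    then show "p \<in> colourings X \<times> cols T"
      using flat[of _ "restrict c X" c for c] by (auto simp: colourings_def)
  next
    fix p assume p: "p \<in> colourings X \<times> cols T"
    obtain c b where [simp]: "p = (c, b)" by (cases p)
    have c: "c \<in> PiE X cols" "\<And>s. s \<in> X \<Longrightarrow> flat s c" and b: "b \<in> cols T"
      using p by (auto simp: colourings_def)
    have "horn_coloured T u c" using c by (intro hc) auto
    then obtain a where a: "a \<in> cols ?\<sigma>" "flat ?\<sigma> (c(?\<sigma> := a, T := b))" "flat T (c(?\<sigma> := a, T := b))"
      using horn_unique[OF card _ _ b, of u c] ex by blast
    let ?c = "c(?\<sigma> := a, T := b)"
    have "flat s ?c" if "s \<in> X" for s
    proof -
      have "t \<noteq> T \<and> t \<noteq> ?\<sigma>" if "t \<in> X" for t using that by auto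
      then show ?thesis using flat[OF that, of ?c c] c(2) that by auto
    qed
    moreover have "?c \<in> PiE ?Y cols"
      using c(1) a b by (auto simp: PiE_def extensional_def)
    ultimately have m: "?c \<in> colourings ?Y"
      using a by (auto simp: colourings_def)
    have e: "p = ?r ?c"
      using c(1) by (auto simp: fun_eq_iff restrict_def PiE_def extensional_def)
    show "p \<in> ?r ` colourings ?Y" unfolding e using m by (rule imageI)
  qed
  from bij_betw_same_card[OF this] show ?thesis by (simp add: card_cartesian_product)
qed

end

section \<open>From the state sum to the normalised count\<close>

lemma prod_grp_delta:
  "finite S \<Longrightarrow> (\<Prod>t\<in>S. grp_delta K (e t)) = (if \<forall>t\<in>S. e t = \<one>\<^bsub>K\<^esub> then real (card (carrier K)) ^ card S else 0)"
  by (induction S rule: finite_induct) (auto simp: grp_delta_def)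

lemma sum_indicator_3:
  assumes "finite A" "finite B" "finite C"
  shows "(\<Sum>x\<in>A. \<Sum>y\<in>B. \<Sum>z\<in>C. if P x y z then k else 0) = real (card {(x, y, z). x \<in> A \<and> y \<in> B \<and> z \<in> C \<and> P x y z}) * k"
proof -
  have "(\<Sum>x\<in>A. \<Sum>y\<in>B. \<Sum>z\<in>C. if P x y z then k else 0)
      = (\<Sum>(x, y, z)\<in>A \<times> B \<times> C. if P x y z then k else 0)"
    by (simp add: sum.cartesian_product)
  also have "\<dots> = (\<Sum>p\<in>{(x, y, z). x \<in> A \<and> y \<in> B \<and> z \<in> C \<and> P x y z}. k)"
    using assms by (intro sum.mono_neutral_cong_right) (auto split: if_splits)
  finally show ?thesis by simp
qed

lemma bij_betw_Collect: "bij_betw f D E \<Longrightarrow> bij_betw f {x \<in> D. Q (f x)} {y \<in> E. Q y}"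
  by (auto simp: bij_betw_def inj_on_def)

lemma faces_eq: "faces K k = {s \<in> simplices K. card s = Suc k}"
  by (auto simp: faces_def simplices_def)

context two_crossed_module_loc
begin

definition nsimp :: "nat set set \<Rightarrow> nat \<Rightarrow> int" where
  "nsimp X k = int (card {s \<in> X. card s = Suc k})"

text \<open>The integrals contribute |G|^(-n1) |H|^(-n2) |L|^(-n3) and the delta functions |G|^n2
  |H|^n3 |L|^n4; these cancel the last two terms of each exponent in the state sum.\<close>

definition normalised_count :: "nat set set \<Rightarrow> real" where
  "normalised_count X =
     real (card (carrier G)) powi (- nsimp X 0) * real (card (carrier H)) powi (nsimp X 0 - nsimp X 1)
     * real (card (carrier L)) powi (- nsimp X 0 + nsimp X 1 - nsimp X 2) * real (card (colourings X))"

lemma nsimp_expansion: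
  assumes "simplicial X" "elementary_expansion X T u" "finite T"
  shows "nsimp (insert T (insert (T - {u}) X)) k
    = nsimp X k + (if card T = Suc k then 1 else 0) + (if card T = Suc (Suc k) then 1 else 0)"
proof -
  have *: "T \<notin> X" "T - {u} \<notin> X" "u \<in> T" "finite X"
    using assms by (auto simp: elementary_expansion_def simplicial_def)
  then have "card (T - {u}) = card T - 1" "card T > 0" using assms(3) by (auto simp: card_gt_0_iff)
  then have "{s \<in> insert T (insert (T - {u}) X). card s = Suc k}
     = (if card T = Suc k then {T} else {}) \<union> (if card T = Suc (Suc k) then {T - {u}} else {}) \<union> {s \<in> X. card s = Suc k}"
    using * by auto
  then show ?thesis unfolding nsimp_def using * by auto
qed

text \<open>The exponents are alternating sums, so raising two consecutive simplex numbers by one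
  affects only the sum that breaks off between them: that of G for an edge T, of H for a triangle,
  of L for a tetrahedron. It drops by one, which pays for the free colour of T.\<close>

lemma normalised_count_expansion:
  assumes fin: "finite (carrier G)" "finite (carrier H)" "finite (carrier L)"
    and X: "simplicial X" "elementary_expansion X T u" and T: "card T \<le> 6"
  shows "normalised_count (insert T (insert (T - {u}) X)) = normalised_count X"
proof -
  have nz: "card (carrier G) \<noteq> 0" "card (carrier H) \<noteq> 0" "card (carrier L) \<noteq> 0"
    using fin by (auto simp: card_eq_0_iff)
  have "T \<noteq> {u}" "u \<in> T" "\<forall>v\<in>T - {u}. T - {v} \<in> X"
    using X(2) by (auto simp: elementary_expansion_def)
  then obtain v where v: "v \<in> T" "v \<noteq> u" "T - {v} \<in> X" by auto
  \<comment> \<open>An infinite T would have cardinality 0 and satisfy the bound; a facet of it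
    lying in X excludes this.\<close>
  then have "finite (T - {v})" using X(1) unfolding simplicial_def by blast
  then have finT: "finite T" by simp
  have "card {u, v} \<le> card T" using v \<open>u \<in> T\<close> finT by (intro card_mono) auto
  then have T2: "card T \<in> {2..6}" using v(2) T by simp
  then consider "card T = 2" | "card T = 3" | "card T = 4" | "card T = 5" | "card T = 6"
    by fastforce
  then show ?thesis
    unfolding normalised_count_def card_colourings_expansion[OF X T2] nsimp_expansion[OF X finT]
    by cases (simp_all add: cols_def card_cartesian_product power_int_add power_int_diff power_int_minus nz field_simps)
qed

text \<open>Extensional functions are \<open>undefined\<close> off their own faces, which is the
  value that \<open>cols\<close> prescribes for the irrelevant components.\<close>

definition pack :: "nat set set \<Rightarrow> (nat set \<Rightarrow> 'g) \<times> (nat set \<Rightarrow> 'h) \<times> (nat set \<Rightarrow> 'l) \<Rightarrow> nat set \<Rightarrow> 'g \<times> 'h \<times> 'l" where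
  "pack X = (\<lambda>(g, h, l). \<lambda>s\<in>X. (g s, h s, l s))"

lemma bij_betw_pack:
  "bij_betw (pack (simplices K)) ((faces K 1 \<rightarrow>\<^sub>E carrier G) \<times> (faces K 2 \<rightarrow>\<^sub>E carrier H) \<times> (faces K 3 \<rightarrow>\<^sub>E carrier L))
     (PiE (simplices K) cols)" (is "bij_betw (pack ?X) ?D _")
proof -
  have sub: "s \<in> ?X" if "s \<in> faces K k" for s k using that by (simp add: faces_eq)
  have colsX: "cols s = (if s \<in> faces K 1 then carrier G else {undefined}) \<times>
     (if s \<in> faces K 2 then carrier H else {undefined}) \<times> (if s \<in> faces K 3 then carrier L else {undefined})"
    if "s \<in> ?X" for s
    using that by (auto simp: faces_eq cols_def)
  have "inj_on (pack ?X) ?D"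
  proof (rule inj_onI)
    fix p q assume p: "p \<in> ?D" and q: "q \<in> ?D" and eq: "pack ?X p = pack ?X q"
    obtain g h l g' h' l' where pq: "p = (g, h, l)" "q = (g', h', l')" by (metis prod.exhaust)
    have *: "g \<in> faces K 1 \<rightarrow>\<^sub>E carrier G" "g' \<in> faces K 1 \<rightarrow>\<^sub>E carrier G"
      "h \<in> faces K 2 \<rightarrow>\<^sub>E carrier H" "h' \<in> faces K 2 \<rightarrow>\<^sub>E carrier H"
      "l \<in> faces K 3 \<rightarrow>\<^sub>E carrier L" "l' \<in> faces K 3 \<rightarrow>\<^sub>E carrier L"
      using p q by (simp_all add: pq)
    have gl: "g s = g' s \<and> h s = h' s \<and> l s = l' s" if "s \<in> ?X" for s
      using fun_cong[OF eq, of s] that by (simp add: pack_def pq)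
    then have "g s = g' s" if "s \<in> faces K 1" for s using sub[OF that] by blast
    moreover have "h s = h' s" if "s \<in> faces K 2" for s using sub[OF that] gl by blast
    moreover have "l s = l' s" if "s \<in> faces K 3" for s using sub[OF that] gl by blast
    ultimately show "p = q"
      unfolding pq using PiE_ext[OF *(1,2)] PiE_ext[OF *(3,4)] PiE_ext[OF *(5,6)] by blast
  qed
  moreover have "pack ?X p \<in> PiE ?X cols" if "p \<in> ?D" for p
  proof -
    have "(fst p s, fst (snd p) s, snd (snd p) s) \<in> cols s" if "s \<in> ?X" for s
      using \<open>p \<in> ?D\<close> by (auto simp: colsX[OF that] PiE_def Pi_def extensional_def)
    then show ?thesis by (auto simp: pack_def split: prod.splits)
  qed
  moreover have "c \<in> pack ?X ` ?D" if c: "c \<in> PiE ?X cols" for c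
  proof (rule image_eqI)
    let ?p = "(\<lambda>s\<in>faces K 1. fst (c s), \<lambda>s\<in>faces K 2. fst (snd (c s)), \<lambda>s\<in>faces K 3. snd (snd (c s)))"
    have cs: "c s \<in> cols s" if "s \<in> ?X" for s using c that by auto
    have "c s = pack ?X ?p s" for s
    proof (cases "s \<in> ?X")
      case True
      then show ?thesis using cs[OF True] by (auto simp: pack_def colsX restrict_def prod_eq_iff mem_Times_iff split: if_splits)
    next
      case False
      then show ?thesis using c by (auto simp: pack_def PiE_def extensional_def)
    qed
    then show "c = pack ?X ?p" by (rule ext)
    have "fst (c s) \<in> carrier G" if "s \<in> faces K 1" for s using cs[OF sub[OF that]] that by (auto simp: colsX[OF sub[OF that]])
    moreover have "fst (snd (c s)) \<in> carrier H" if "s \<in> faces K 2" for s using cs[OF sub[OF that]] that by (auto simp: colsX[OF sub[OF that]])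
    moreover have "snd (snd (c s)) \<in> carrier L" if "s \<in> faces K 3" for s using cs[OF sub[OF that]] that by (auto simp: colsX[OF sub[OF that]])
    ultimately show "?p \<in> ?D" by simp
  qed
  ultimately show ?thesis unfolding bij_betw_def by blast
qed

lemma card_colourings:
  "card (colourings (simplices K)) = card {(g, h, l). g \<in> faces K 1 \<rightarrow>\<^sub>E carrier G \<and>
     h \<in> faces K 2 \<rightarrow>\<^sub>E carrier H \<and> l \<in> faces K 3 \<rightarrow>\<^sub>E carrier L \<and>
     (\<forall>s\<in>simplices K. flat s (pack (simplices K) (g, h, l)))}" (is "_ = card ?D")
proof -
  have "?D = {p \<in> (faces K 1 \<rightarrow>\<^sub>E carrier G) \<times> (faces K 2 \<rightarrow>\<^sub>E carrier H) \<times> (faces K 3 \<rightarrow>\<^sub>E carrier L).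
      \<forall>s\<in>simplices K. flat s (pack (simplices K) p)}"
    by auto
  then show ?thesis
    unfolding colourings_def
    using bij_betw_same_card[OF bij_betw_Collect[OF bij_betw_pack, where Q = "\<lambda>c. \<forall>s\<in>simplices K. flat s c"]]
    by simp
qed

lemma flat_pack_iff:
  fixes K :: "nat set set"
  defines "c \<equiv> \<lambda>g h l. pack (simplices K) (g, h, l)"
  shows "(\<forall>s\<in>simplices K. flat s (c g h l)) \<longleftrightarrow>
    (\<forall>t\<in>faces K 2. let a = vx t 0; b = vx t 1; c = vx t 2 in
       bd (h t) \<otimes>\<^bsub>G\<^esub> g {b,c} \<otimes>\<^bsub>G\<^esub> g {a,b} \<otimes>\<^bsub>G\<^esub> inv\<^bsub>G\<^esub> (g {a,c}) = \<one>\<^bsub>G\<^esub>) \<and>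
    (\<forall>s\<in>faces K 3. let a = vx s 0; b = vx s 1; c = vx s 2; d = vx s 3 in
       dl (l s) \<otimes>\<^bsub>H\<^esub> h {a,c,d} \<otimes>\<^bsub>H\<^esub> aH (g {c,d}) (h {a,b,c})
         \<otimes>\<^bsub>H\<^esub> inv\<^bsub>H\<^esub> (h {b,c,d}) \<otimes>\<^bsub>H\<^esub> inv\<^bsub>H\<^esub> (h {a,b,d}) = \<one>\<^bsub>H\<^esub>) \<and>
    (\<forall>p\<in>faces K 4. let a = vx p 0; b = vx p 1; c = vx p 2; d = vx p 3; e = vx p 4 in
       inv\<^bsub>L\<^esub> (l {a,c,d,e})
         \<otimes>\<^bsub>L\<^esub> actH H L dl pl (h {a,c,e}) (pl (h {c,d,e}) (aH (g {d,e} \<otimes>\<^bsub>G\<^esub> g {c,d}) (h {a,b,c})))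
         \<otimes>\<^bsub>L\<^esub> inv\<^bsub>L\<^esub> (l {a,b,c,e})
         \<otimes>\<^bsub>L\<^esub> actH H L dl pl (h {a,b,e}) (l {b,c,d,e})
         \<otimes>\<^bsub>L\<^esub> l {a,b,d,e}
         \<otimes>\<^bsub>L\<^esub> actH H L dl pl (h {a,d,e}) (aL (g {d,e}) (l {a,b,c,d})) = \<one>)"
    (is "_ \<longleftrightarrow> (\<forall>t\<in>_. ?t t) \<and> (\<forall>t\<in>_. ?T t) \<and> (\<forall>t\<in>_. ?P t)")
proof -
  let ?c = "c g h l"
  have down: "t \<in> simplices K" if "s \<in> simplices K" "t \<subseteq> s" "t \<noteq> {}" for s t
    using that unfolding simplices_def by blast
  have C: "gc ?c x y = g {x,y}" "hc ?c x y z = h {x,y,z}" "lc ?c x y z w = l {x,y,z,w}"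
    if "s \<in> simplices K" "{x,y,z,w} \<subseteq> s" for s x y z w
    using that down[OF that(1), of "{x,y}"] down[OF that(1), of "{x,y,z}"] down[OF that(1), of "{x,y,z,w}"]
    by (simp_all add: gc_def hc_def lc_def c_def pack_def)
  \<comment> \<open>Repeating the last vertex turns a smaller face into an instance of
    \<open>C\<close>.\<close>
  have C2: "gc ?c x y = g {x,y}" if "s \<in> simplices K" "{x,y} \<subseteq> s" for s x y
    using C(1)[of s x y y y] that by simp
  have C3: "hc ?c x y z = h {x,y,z}" if "s \<in> simplices K" "{x,y,z} \<subseteq> s" for s x y z
    using C(2)[of s x y z z] that by simp
  have 3: "flat s ?c \<longleftrightarrow> ?t s" if s: "s \<in> simplices K" and "card s = 3" for s
  proof -
    obtain x y z where e: "s = {x,y,z}" "x < y" "y < z" by (rule card_3_cases[OF \<open>card s = 3\<close>])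
    then show ?thesis using vx_3[of x y z] by (simp add: flat_tri_def C2[OF s] C3[OF s] Let_def del: One_nat_def)
  qed
  have 4: "flat s ?c \<longleftrightarrow> ?T s" if s: "s \<in> simplices K" and "card s = 4" for s
  proof -
    obtain x y z w where e: "s = {x,y,z,w}" "x < y" "y < z" "z < w" by (rule card_4_cases[OF \<open>card s = 4\<close>])
    then show ?thesis using vx_4[of x y z w] by (simp add: flat_tet_def C2[OF s] C3[OF s] C(3)[OF s] Let_def del: One_nat_def)
  qed
  have 5: "flat s ?c \<longleftrightarrow> ?P s" if s: "s \<in> simplices K" and "card s = 5" for s
  proof -
    obtain x y z w v where e: "s = {x,y,z,w,v}" "x < y" "y < z" "z < w" "w < v" by (rule card_5_cases[OF \<open>card s = 5\<close>])
    then show ?thesis using vx_5[of x y z w v] by (simp add: curv_def C2[OF s] C3[OF s] C(3)[OF s] Let_def del: One_nat_def)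
  qed
  have "(\<forall>s\<in>simplices K. flat s ?c) \<longleftrightarrow>
      (\<forall>s\<in>faces K 2. flat s ?c) \<and> (\<forall>s\<in>faces K 3. flat s ?c) \<and> (\<forall>s\<in>faces K 4. flat s ?c)"
    by (auto simp: faces_eq) (metis flat_simps(4) insertE emptyE)
  also have "\<dots> \<longleftrightarrow> (\<forall>t\<in>faces K 2. ?t t) \<and> (\<forall>t\<in>faces K 3. ?T t) \<and> (\<forall>t\<in>faces K 4. ?P t)"
    using 3 4 5 by (simp add: faces_eq)
  finally show ?thesis .
qed

lemma state_sum_eq_normalised_count:
  assumes fin: "finite (carrier G)" "finite (carrier H)" "finite (carrier L)"
    and K: "finite K" "\<And>F. F \<in> K \<Longrightarrow> finite F"
  shows "state_sum G H L bd dl aH aL pl K = normalised_count (simplices K)"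
proof -
  have nz: "card (carrier G) \<noteq> 0" "card (carrier H) \<noteq> 0" "card (carrier L) \<noteq> 0"
    using fin by (auto simp: card_eq_0_iff)
  have fF [simp]: "finite (faces K k)" for k
    using simplicial_simplices[OF K] by (simp add: faces_eq simplicial_def)
  have n: "nsimp (simplices K) k = int (card (faces K k))" for k
    by (simp add: nsimp_def faces_eq)
  have if3: "(if A then x else 0) * (if B then y else 0) * (if C then z else 0) = (if A \<and> B \<and> C then x * y * z else (0::real))"
    for A B C x y z by simp
  have fin3: "finite (faces K 1 \<rightarrow>\<^sub>E carrier G)" "finite (faces K 2 \<rightarrow>\<^sub>E carrier H)" "finite (faces K 3 \<rightarrow>\<^sub>E carrier L)"
    using fin by (simp_all add: finite_PiE)
  show ?thesis
    unfolding state_sum_def grp_multi_int_def Let_def prod_grp_delta[OF fF] if3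
      flat_pack_iff[unfolded Let_def, symmetric] sum_divide_distrib[symmetric]
      sum_indicator_3[OF fin3] card_colourings[symmetric] normalised_count_def n
    using nz by (simp add: power_int_add power_int_diff power_int_minus field_simps)
qed

end

theorem mainTheorem1:
  fixes G :: "('g, 'a) monoid_scheme" and H :: "('h, 'b) monoid_scheme"
    and L :: "('l, 'c) monoid_scheme"
    and bd :: "'h \<Rightarrow> 'g" and dl :: "'l \<Rightarrow> 'h"
    and aH :: "'g \<Rightarrow> 'h \<Rightarrow> 'h" and aL :: "'g \<Rightarrow> 'l \<Rightarrow> 'l"
    and pl :: "'h \<Rightarrow> 'h \<Rightarrow> 'l"
    and K K' :: "nat set set"
  assumes "two_crossed_module G H L bd dl aH aL pl"
    and "finite (carrier G)" and "finite (carrier H)" and "finite (carrier L)"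
    and "pachner_move\<^sup>*\<^sup>* K K'"
  shows "state_sum G H L bd dl aH aL pl K = state_sum G H L bd dl aH aL pl K'"
  using assms(5)
proof (induction rule: rtranclp_induct)
  case base
  show ?case ..
next
  case (step K' K'')
  interpret two_crossed_module_loc G H L bd dl aH aL pl by unfold_locales (rule assms(1))
  have mfd: "finite J" "\<And>F. F \<in> J \<Longrightarrow> finite F" if "closed_oriented_triangulated_4manifold J" for J
    using that unfolding closed_oriented_triangulated_4manifold_def closed_comb_manifold_def
    by (auto intro: card_ge_0_finite)
  have m: "closed_oriented_triangulated_4manifold K'" "closed_oriented_triangulated_4manifold K''"
    and move: "bistellar_move 4 K' K''"
    using step.hyps(2) by (simp_all add: pachner_move_def)
  \<comment> \<open>For moves of dimension 4 all expansions have at most 4 + 2 = 6 vertices, the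
    range in which horns have unique fillers.\<close>
  have "normalised_count (simplices K') = normalised_count (simplices K'')"
    by (rule bistellar_move_invariant[OF move mfd[OF m(1)]])
      (simp_all add: normalised_count_expansion assms)
  then show ?case
    using step.IH by (simp add: state_sum_eq_normalised_count assms mfd[OF m(1)] mfd[OF m(2)])
qed

end
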